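(* For deadlock-free P-VASS-MDPs of dimension $2$, the almost-sure reachability, limit-sure reachability, almost-sure repeated reachability and limit-sure repeated reachability problems are undecidable.
   Context: A VASS-MDP of dimension $d\ge 0$ is a tuple $S=\langle Q,Q_1,Q_P,T,\tau\rangle$ where $Q$ is a finite set of control states partitioned into $Q_1$ (Player 1) and $Q_P$ (probabilistic), $T\subseteq Q\times\mathbb{Z}^d\times Q$ is finite, and $\tau:T\to\mathbb{N}_{>0}$. Configurations are $\langle q,\mathbf{v}\rangle\in Q\times\mathbb{N}^d$; $t=\langle q,\mathbf{z},q'\rangle$ is enabled in $\langle q,\mathbf{v}\rangle$ if $\mathbf{v}+\mathbf{z}\in\mathbb{N}^d$ and leads to $\langle q',\mathbf{v}+\mathbf{z}\rangle$. The induced MDP $M_S=\langle C,C_1,C_P,\rightarrow,p\rangle$ has $C=Q\times\mathbb{N}^d$, $C_1=Q_1\times\mathbb{N}^d$, $C_P=Q_P\times\mathbb{N}^d$, $c\rightarrow c'$ iff $c'$ is obtained from $c$ by an enabled transition, and for $c\in C_P$, $p(c)(c')$ is the total weight of enabled transitions from $c$ leading to $c'$ divided by the total weight of transitions enabled in $c$. $S$ is deadlock-free if every configuration of $M_S$ has a successor. A P-VASS-MDP is a VASS-MDP in which every transition $\langle q,\mathbf{z},q'\rangle$ with $q\in Q_1$ has $\mathbf{z}=\mathbf{0}$. A strategy $\sigma$ of Player 1 maps each finite play ending in $c\in C_1$ to a successor of $c$; an initial configuration $c$ and $\sigma$ induce a probability measure $\mathbb{P}(M_S,c,\sigma,\cdot)$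 on plays. For $q_F\in Q$, $[\![\Diamond q_F]\!]$ (resp. $[\![\Box\Diamond q_F]\!]$) is the set of plays visiting control state $q_F$ at least once (resp. infinitely often). Given $S$, $c_0$ and $q_F$: the almost-sure (repeated) reachability problem asks whether some $\sigma$ gives $\mathbb{P}(M_S,c_0,\sigma,[\![\Diamond q_F]\!])=1$ (resp. with $[\![\Box\Diamond q_F]\!]$); the limit-sure (repeated) reachability problem asks whether $\sup_\sigma \mathbb{P}(M_S,c_0,\sigma,[\![\Diamond q_F]\!])=1$ (resp. with $[\![\Box\Diamond q_F]\!]$). *)

theory Defs
  imports "HOL-Probability.Probability" "HOL-Library.Nat_Bijection"
begin

section \<open>Markov decision processes\<close>

record 'c mdp =
  confs :: "'c set"
  confs1 :: "'c set"
  confsP :: "'c set"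
  step :: "'c \<Rightarrow> 'c \<Rightarrow> bool"
  move_prob :: "'c \<Rightarrow> 'c \<Rightarrow> real"

definition finite_play :: "'c mdp \<Rightarrow> 'c list \<Rightarrow> bool" where
  "finite_play M w \<longleftrightarrow> w \<noteq> [] \<and> set w \<subseteq> confs M \<and> successively (step M) w"

definition plays :: "'c mdp \<Rightarrow> (nat \<Rightarrow> 'c) set" where
  "plays M = {\<omega>. \<forall>i. \<omega> i \<in> confs M \<and> step M (\<omega> i) (\<omega> (Suc i))}"

text \<open>All plays considered below are infinite, as the MDPs of interest are deadlock-free.
  A strategy is a total function on lists; its values outside the finite plays that end in a
  Player 1 configuration are irrelevant.\<close>

definition strategy :: "'c mdp \<Rightarrow> ('c list \<Rightarrow> 'c) \<Rightarrow> bool" where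
  "strategy M \<sigma> \<longleftrightarrow>
     (\<forall>w. finite_play M w \<and> last w \<in> confs1 M \<longrightarrow> step M (last w) (\<sigma> w))"

definition next_conf :: "'c mdp \<Rightarrow> 'c \<Rightarrow> ('c list \<Rightarrow> 'c) \<Rightarrow> 'c list \<Rightarrow> 'c pmf" where
  "next_conf M c \<sigma> w =
     (if w = [] then return_pmf c
      else if last w \<in> confsP M then embed_pmf (move_prob M (last w))
      else return_pmf (\<sigma> w))"

definition play_kernel ::
    "'c mdp \<Rightarrow> 'c \<Rightarrow> ('c list \<Rightarrow> 'c) \<Rightarrow> nat \<Rightarrow> (nat \<Rightarrow> 'c) \<Rightarrow> 'c measure" where
  "play_kernel M c \<sigma> n \<omega> = measure_pmf (next_conf M c \<sigma> (map \<omega> [0..<n]))"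

text \<open>The measure on infinite sequences of configurations obtained from the kernels by the
  Ionescu-Tulcea theorem; its values on cylinders are computed in \<open>play_measure_cylinder\<close>.\<close>

definition play_measure ::
    "'c::countable mdp \<Rightarrow> 'c \<Rightarrow> ('c list \<Rightarrow> 'c) \<Rightarrow> (nat \<Rightarrow> 'c) measure" where
  "play_measure M c \<sigma> =
     projective_family.lim UNIV
       (Ionescu_Tulcea.CI (play_kernel M c \<sigma>) (\<lambda>_. count_space UNIV)) (\<lambda>_. count_space UNIV)"

lemma Ionescu_Tulcea_play_kernel:
  fixes M :: "'c::countable mdp"
  shows "Ionescu_Tulcea (play_kernel M c \<sigma>) (\<lambda>_. count_space UNIV)"
proof (rule Ionescu_Tulcea.intro)
  fix n
  have "(\<lambda>\<omega>. map \<omega> [0..<n]) \<in> measurable (PiM {0..<n} (\<lambda>_. count_space UNIV))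
          (count_space (UNIV :: 'c list set))"
  proof (subst measurable_count_space_eq2_countable, intro conjI ballI)
    fix w :: "'c list"
    let ?N = "PiM {0..<n} (\<lambda>_. count_space (UNIV :: 'c set))"
    have "(\<lambda>\<omega>. map \<omega> [0..<n]) -` {w} \<inter> space ?N =
        (if length w = n then PiE {0..<n} (\<lambda>i. {w ! i}) else {})"
    proof -
      have "map \<omega> [0..<n] = w \<longleftrightarrow> length w = n \<and> (\<forall>i<n. \<omega> i = w ! i)" for \<omega>
        unfolding list_eq_iff_nth_eq by auto
      then show ?thesis
        by (simp add: set_eq_iff space_PiM PiE_iff Ball_def)
    qed
    then show "(\<lambda>\<omega>. map \<omega> [0..<n]) -` {w} \<inter> space ?N \<in> sets ?N"
      by (simp add: sets_PiM_I_finite)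
  qed simp_all
  then show "play_kernel M c \<sigma> n \<in>
      measurable (PiM {0..<n} (\<lambda>_. count_space UNIV)) (subprob_algebra (count_space UNIV))"
    unfolding play_kernel_def
    by (rule measurable_compose) (simp add: measure_pmf_in_subprob_algebra)
next
  fix n \<omega>
  show "prob_space (play_kernel M c \<sigma> n \<omega>)"
    unfolding play_kernel_def by (rule measure_pmf.prob_space_axioms)
qed

lemma prob_space_play_measure: "prob_space (play_measure M c \<sigma>)"
  and sets_play_measure: "sets (play_measure M c \<sigma>) = sets (PiM UNIV (\<lambda>_. count_space UNIV))"
proof -
  interpret Ionescu_Tulcea "play_kernel M c \<sigma>" "\<lambda>_. count_space UNIV"
    by (rule Ionescu_Tulcea_play_kernel)
  show "prob_space (play_measure M c \<sigma>)"
  proof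
    have "emeasure PF.lim (PF.emb UNIV {} {\<lambda>_. undefined}) = emeasure (CI {}) {\<lambda>_. undefined}"
      by (rule lim) (auto simp: PiM_empty)
    moreover have "emeasure (CI {}) (space (CI {})) = 1"
      by (intro prob_space.emeasure_space_1 PF.prob_space_P) auto
    moreover have "PF.emb UNIV {} {\<lambda>_. undefined} = space PF.lim"
      by (auto simp: prod_emb_def space_PiM)
    ultimately show "emeasure (play_measure M c \<sigma>) (space (play_measure M c \<sigma>)) = 1"
      by (simp add: play_measure_def PF.space_P space_PiM)
  qed
  show "sets (play_measure M c \<sigma>) = sets (PiM UNIV (\<lambda>_. count_space UNIV))"
    unfolding play_measure_def by simp
qed

lemma play_measure_cylinder:
  "measure (play_measure M c \<sigma>) {\<omega>. \<forall>i<n. \<omega> i = ws i} =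
     (\<Prod>i<n. pmf (next_conf M c \<sigma> (map ws [0..<i])) (ws i))"
proof -
  interpret Ionescu_Tulcea "play_kernel M c \<sigma>" "\<lambda>_. count_space UNIV"
    by (rule Ionescu_Tulcea_play_kernel)
  let ?N = "\<lambda>n. PiM {0..<n} (\<lambda>_. count_space (UNIV :: 'a set))"
  have cyl: "{\<omega> \<in> space (?N m). \<forall>i<m. \<omega> i = ws i} = {restrict ws {0..<m}}" for m
    by (auto simp: space_PiM PiE_iff extensional_def restrict_def fun_eq_iff)
  have [measurable]: "{restrict ws {0..<m}} \<in> sets (?N m)" for m
    unfolding cyl[symmetric] by measurable
  have C: "emeasure (C 0 m (\<lambda>_. undefined)) {restrict ws {0..<m}} =
      ennreal (\<Prod>i<m. pmf (next_conf M c \<sigma> (map ws [0..<i])) (ws i))" for m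
  proof (induction m)
    case 0
    then show ?case
      by (auto simp: PiM_empty restrict_def)
  next
    case (Suc m)
    let ?r = "restrict ws {0..<m}"
    have "emeasure (C 0 (Suc m) (\<lambda>_. undefined)) {restrict ws {0..<Suc m}} =
        (\<integral>\<^sup>+\<omega>. emeasure (eP m \<omega>) {restrict ws {0..<Suc m}} \<partial>C 0 m (\<lambda>_. undefined))"
      using measurable_eP[of m]
      by (simp, subst emeasure_bind[where N = "?N (Suc m)"])
        (auto simp: space_C space_PiM PiE_iff measurable_cong_sets[OF sets_C])
    also have "\<dots> = (\<integral>\<^sup>+\<omega>. ennreal (pmf (next_conf M c \<sigma> (map ws [0..<m])) (ws m)) *
        indicator {?r} \<omega> \<partial>C 0 m (\<lambda>_. undefined))"
    proof (rule nn_integral_cong)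
      fix \<omega> assume "\<omega> \<in> space (C 0 m (\<lambda>_. undefined))"
      then have \<omega>: "\<omega> \<in> space (?N m)"
        by (simp add: space_C)
      have vi: "fun_upd \<omega> m -` {restrict ws {0..<Suc m}} = (if \<omega> = ?r then {ws m} else {})"
      proof -
        have "fun_upd \<omega> m x = restrict ws {0..<Suc m} \<longleftrightarrow> \<omega> = ?r \<and> x = ws m" for x
          using \<omega> by (auto simp: space_PiM PiE_iff extensional_def fun_eq_iff less_Suc_eq restrict_def)
        then show ?thesis by auto
      qed
      have "map ?r [0..<m] = map ws [0..<m]"
        by simp
      then show "emeasure (eP m \<omega>) {restrict ws {0..<Suc m}} =
          ennreal (pmf (next_conf M c \<sigma> (map ws [0..<m])) (ws m)) * indicator {?r} \<omega>"
        using \<omega> by (subst emeasure_eP)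
          (auto simp: vi play_kernel_def emeasure_pmf_single simp del: map_eq_conv)
    qed
    also have "\<dots> = ennreal (pmf (next_conf M c \<sigma> (map ws [0..<m])) (ws m)) *
        emeasure (C 0 m (\<lambda>_. undefined)) {?r}"
      by (subst nn_integral_cmult_indicator) (auto simp: sets_C space_PiM PiE_iff)
    also have "\<dots> = ennreal (\<Prod>i<Suc m. pmf (next_conf M c \<sigma> (map ws [0..<i])) (ws i))"
      by (simp add: Suc ennreal_mult' mult.commute prod_nonneg)
    finally show ?case .
  qed
  let ?X = "{restrict ws {0..<n}}"
  have "{\<omega>. \<forall>i<n. \<omega> i = ws i} = PF.emb UNIV {0..<n} ?X"
  proof -
    have "(\<forall>i<n. \<omega> i = ws i) \<longleftrightarrow> restrict \<omega> {0..<n} = restrict ws {0..<n}" for \<omega>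
      unfolding restrict_def fun_eq_iff by simp
    then show ?thesis
      by (simp add: prod_emb_def space_PiM vimage_def)
  qed
  then have "emeasure (play_measure M c \<sigma>) {\<omega>. \<forall>i<n. \<omega> i = ws i} =
      emeasure PF.lim (PF.emb UNIV {0..<n} ?X)"
    by (simp only: play_measure_def)
  also have "\<dots> = emeasure (CI {0..<n}) ?X"
    by (rule lim) auto
  also have "\<dots> = emeasure (C 0 n (\<lambda>_. undefined)) (PF.emb {0..<n} {0..<n} ?X)"
    by (rule emeasure_CI) auto
  also have "PF.emb {0..<n} {0..<n} ?X = ?X"
    by (rule prod_emb_id) (simp add: PiE_iff)
  finally have "emeasure (play_measure M c \<sigma>) {\<omega>. \<forall>i<n. \<omega> i = ws i} =
      emeasure (C 0 n (\<lambda>_. undefined)) ?X" .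
  then show ?thesis
    by (simp add: C measure_def prod_nonneg)
qed


section \<open>VASS-MDPs\<close>

type_synonym 'q transition = "'q \<times> int list \<times> 'q"
type_synonym 'q conf = "'q \<times> nat list"

record 'q vass =
  states :: "'q set"
  states1 :: "'q set"
  statesP :: "'q set"
  trans :: "'q transition set"
  weight :: "'q transition \<Rightarrow> nat"

text \<open>Vectors of dimension \<open>d\<close> are lists of length \<open>d\<close>.\<close>

definition vass_mdp :: "nat \<Rightarrow> 'q vass \<Rightarrow> bool" where
  "vass_mdp d S \<longleftrightarrow>
     finite (states S) \<and> states1 S \<union> statesP S = states S \<and> states1 S \<inter> statesP S = {} \<and>
     finite (trans S) \<and> trans S \<subseteq> states S \<times> {z. length z = d} \<times> states S \<and>
     (\<forall>t\<in>trans S. weight S t > 0)"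

definition vec_add :: "nat list \<Rightarrow> int list \<Rightarrow> int list" where
  "vec_add v z = map2 (+) (map int v) z"

definition enabled :: "'q vass \<Rightarrow> 'q conf \<Rightarrow> 'q transition set" where
  "enabled S c = {(q, z, q') \<in> trans S. q = fst c \<and> (\<forall>x\<in>set (vec_add (snd c) z). x \<ge> 0)}"

definition target :: "'q conf \<Rightarrow> 'q transition \<Rightarrow> 'q conf" where
  "target c t = (case t of (q, z, q') \<Rightarrow> (q', map nat (vec_add (snd c) z)))"

definition induced_mdp :: "nat \<Rightarrow> 'q vass \<Rightarrow> 'q conf mdp" where
  "induced_mdp d S = \<lparr>
     confs = states S \<times> {v. length v = d},
     confs1 = states1 S \<times> {v. length v = d},
     confsP = statesP S \<times> {v. length v = d},
     step = (\<lambda>c c'. c \<in> states S \<times> {v. length v = d} \<and> (\<exists>t\<in>enabled S c. target c t = c')),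
     move_prob = (\<lambda>c c'. real (\<Sum>t\<in>{t\<in>enabled S c. target c t = c'}. weight S t) /
                    real (\<Sum>t\<in>enabled S c. weight S t)) \<rparr>"

definition deadlock_free :: "nat \<Rightarrow> 'q vass \<Rightarrow> bool" where
  "deadlock_free d S \<longleftrightarrow>
     (\<forall>c\<in>confs (induced_mdp d S). \<exists>c'. step (induced_mdp d S) c c')"

definition p_vass_mdp :: "nat \<Rightarrow> 'q vass \<Rightarrow> bool" where
  "p_vass_mdp d S \<longleftrightarrow>
     vass_mdp d S \<and> (\<forall>(q, z, q')\<in>trans S. q \<in> states1 S \<longrightarrow> z = replicate d 0)"

lemma pmf_embed_prob:
  assumes "vass_mdp d S" "step (induced_mdp d S) c c'"
  shows "pmf (embed_pmf (move_prob (induced_mdp d S) c)) = move_prob (induced_mdp d S) c"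
proof -
  have fin: "finite (enabled S c)"
    using assms(1) by (rule_tac finite_subset[of _ "trans S"]) (auto simp: enabled_def vass_mdp_def)
  let ?W = "real (\<Sum>t\<in>enabled S c. weight S t)"
  obtain t where t: "t \<in> enabled S c"
    using assms(2) by (auto simp: induced_mdp_def)
  have "weight S t > 0"
    using t assms(1) by (auto simp: enabled_def vass_mdp_def)
  then have W: "?W > 0"
    using t fin by (metis of_nat_0_less_iff sum_pos2 zero_le)
  let ?p = "move_prob (induced_mdp d S) c"
  have nonneg: "0 \<le> ?p x" for x
    by (simp add: induced_mdp_def sum_nonneg)
  have zero: "?p x = 0" if "x \<notin> target c ` enabled S c" for x
  proof -
    have none: "{t \<in> enabled S c. target c t = x} = {}"
      using that by auto
    show ?thesis
      by (simp add: induced_mdp_def none)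
  qed
  have "(\<integral>\<^sup>+x. ennreal (?p x) \<partial>count_space UNIV) = (\<Sum>x\<in>target c ` enabled S c. ennreal (?p x))"
    using fin by (intro nn_integral_count_space') (auto simp: zero)
  also have "\<dots> = ennreal (\<Sum>x\<in>target c ` enabled S c. ?p x)"
    by (simp add: nonneg)
  also have "(\<Sum>x\<in>target c ` enabled S c. ?p x) = 1"
  proof -
    have "(\<Sum>x\<in>target c ` enabled S c. ?p x) =
      real (\<Sum>x\<in>target c ` enabled S c. \<Sum>t\<in>{t \<in> enabled S c. target c t = x}. weight S t) / ?W"
      by (simp add: induced_mdp_def sum_divide_distrib)
    also have "\<dots> = ?W / ?W"
      using sum.image_gen[OF fin, of "weight S" "target c"] by simp
    finally show ?thesis
      using W by simp
  qed
  finally have "(\<integral>\<^sup>+x. ennreal (?p x) \<partial>count_space UNIV) = 1"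
    by simp
  then show ?thesis
    using pmf_embed_pmf[of ?p] nonneg by auto
qed


section \<open>Qualitative reachability problems\<close>

definition reach :: "nat \<Rightarrow> 'q vass \<Rightarrow> 'q \<Rightarrow> (nat \<Rightarrow> 'q conf) set" where
  "reach d S qF = {\<omega> \<in> plays (induced_mdp d S). \<exists>i. fst (\<omega> i) = qF}"

definition repeated_reach :: "nat \<Rightarrow> 'q vass \<Rightarrow> 'q \<Rightarrow> (nat \<Rightarrow> 'q conf) set" where
  "repeated_reach d S qF = {\<omega> \<in> plays (induced_mdp d S). \<exists>\<^sub>\<infinity>i. fst (\<omega> i) = qF}"

definition almost_sure :: "'c::countable mdp \<Rightarrow> 'c \<Rightarrow> (nat \<Rightarrow> 'c) set \<Rightarrow> bool" where
  "almost_sure M c E \<longleftrightarrow> (\<exists>\<sigma>. strategy M \<sigma> \<and> measure (play_measure M c \<sigma>) E = 1)"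

definition limit_sure :: "'c::countable mdp \<Rightarrow> 'c \<Rightarrow> (nat \<Rightarrow> 'c) set \<Rightarrow> bool" where
  "limit_sure M c E \<longleftrightarrow> (SUP \<sigma>\<in>{\<sigma>. strategy M \<sigma>}. measure (play_measure M c \<sigma>) E) = 1"

lemma reach_in_sets:
  fixes S :: "'q::countable vass"
  shows "reach d S qF \<in> sets (play_measure M c \<sigma>)"
    and "repeated_reach d S qF \<in> sets (play_measure M c \<sigma>)"
proof -
  let ?N = "PiM UNIV (\<lambda>_::nat. count_space (UNIV :: 'q conf set))"
  have comp: "(\<lambda>\<omega>. \<omega> i) \<in> measurable ?N (count_space UNIV)" for i
    by (rule measurable_component_singleton) simp
  have pred1: "Measurable.pred ?N (\<lambda>\<omega>. R (\<omega> i))" for R i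
    by (rule measurable_compose[OF comp]) simp
  have pred2: "Measurable.pred ?N (\<lambda>\<omega>. R (\<omega> i) (\<omega> j))" for R i j
    by (rule measurable_compose_countable'[where I = UNIV and g = "\<lambda>\<omega>. \<omega> i"
          and f = "\<lambda>x \<omega>. R x (\<omega> j)"]) (simp_all add: pred1 comp)
  have plays: "Measurable.pred ?N (\<lambda>\<omega>. \<omega> \<in> plays (induced_mdp d S))"
    unfolding plays_def mem_Collect_eq
    by (rule pred_intros_countable(1), rule pred2)
  have conj: "Measurable.pred ?N (\<lambda>\<omega>. A \<omega> \<and> B \<omega>)"
    if "Measurable.pred ?N A" "Measurable.pred ?N B" for A B
    using that by (rule pred_intros_logic)
  have sets: "{\<omega>. Q \<omega>} \<in> sets (play_measure M c \<sigma>)" if "Measurable.pred ?N Q" for Q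
    using that by (simp add: pred_def space_PiM sets_play_measure)
  show "reach d S qF \<in> sets (play_measure M c \<sigma>)"
    unfolding reach_def
    by (rule sets, rule conj, rule plays,
        rule pred_intros_countable(2), rule pred1)
  show "repeated_reach d S qF \<in> sets (play_measure M c \<sigma>)"
    unfolding repeated_reach_def INFM_nat_le
    by (rule sets, rule conj, rule plays,
        rule pred_intros_countable(1), rule pred_intros_countable(2),
        rule conj, simp, rule pred1)
qed


section \<open>Computability\<close>

text \<open>Terms for the partial recursive functions. \<open>computes f xs y\<close> says that the function
  denoted by \<open>f\<close> is defined on the arguments \<open>xs\<close> with value \<open>y\<close>. Arities are not recorded;
  an ill-formed application computes no value or ignores superfluous arguments, so that for each
  \<open>k\<close> the terms denote on lists of length \<open>k\<close> precisely the \<open>k\<close>-ary partial recursive functions.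
  Recursion and minimisation act on the first argument.\<close>

datatype recf = Zero | Succ | Proj nat | Comp recf "recf list" | PrimRec recf recf | Mu recf

inductive computes :: "recf \<Rightarrow> nat list \<Rightarrow> nat \<Rightarrow> bool" where
  "computes Zero xs 0"
| "computes Succ (x # xs) (Suc x)"
| "i < length xs \<Longrightarrow> computes (Proj i) xs (xs ! i)"
| "list_all2 (\<lambda>g y. computes g xs y) gs ys \<Longrightarrow> computes f ys z \<Longrightarrow> computes (Comp f gs) xs z"
| "computes f xs y \<Longrightarrow> computes (PrimRec f g) (0 # xs) y"
| "computes (PrimRec f g) (n # xs) y \<Longrightarrow> computes g (n # y # xs) z \<Longrightarrow>
     computes (PrimRec f g) (Suc n # xs) z"
| "computes f (n # xs) 0 \<Longrightarrow> \<forall>i<n. \<exists>y>0. computes f (i # xs) y \<Longrightarrow> computes (Mu f) xs n"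

text \<open>A decision problem given by a set \<open>I\<close> of inputs, a coding \<open>e\<close> of inputs by numbers and a
  property \<open>P\<close> is decidable if some algorithm halts on the code of each input in \<open>I\<close> with the
  correct answer. Nothing is required of it on other numbers, so undecidability in this sense
  does not hinge on the recognition of inputs.\<close>

definition decidable :: "'a set \<Rightarrow> ('a \<Rightarrow> nat) \<Rightarrow> ('a \<Rightarrow> bool) \<Rightarrow> bool" where
  "decidable I e P \<longleftrightarrow> (\<exists>f. \<forall>x\<in>I. computes f [e x] (if P x then 1 else 0))"


section \<open>Problem inputs\<close>

text \<open>A VASS-MDP is presented by its Player 1 states, its probabilistic states and its weighted
  transitions; as \<open>Q\<close> is finite, one may take the states to be natural numbers. An input
  consists of a presentation, an initial configuration and a state \<open>q\<^sub>F\<close>.\<close>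

type_synonym presentation = "nat list \<times> nat list \<times> (nat transition \<times> nat) list"
type_synonym input = "presentation \<times> nat conf \<times> nat"

fun vass_of :: "presentation \<Rightarrow> nat vass" where
  "vass_of (qs1, qsP, ts) = \<lparr>
     states = set qs1 \<union> set qsP,
     states1 = set qs1,
     statesP = set qsP,
     trans = fst ` set ts,
     weight = (\<lambda>t. the (map_of ts t)) \<rparr>"

definition inputs :: "nat \<Rightarrow> input set" where
  "inputs d = {((qs1, qsP, ts), c, qF).
     distinct (map fst ts) \<and>
     p_vass_mdp d (vass_of (qs1, qsP, ts)) \<and> deadlock_free d (vass_of (qs1, qsP, ts)) \<and>
     c \<in> confs (induced_mdp d (vass_of (qs1, qsP, ts))) \<and>
     qF \<in> states (vass_of (qs1, qsP, ts))}"

fun transition_encode :: "nat transition \<times> nat \<Rightarrow> nat" where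
  "transition_encode ((q, z, q'), w) =
     list_encode [q, list_encode (map int_encode z), q', w]"

fun input_encode :: "input \<Rightarrow> nat" where
  "input_encode ((qs1, qsP, ts), (q, v), qF) =
     list_encode [list_encode qs1, list_encode qsP, list_encode (map transition_encode ts),
       q, list_encode v, qF]"

fun almost_sure_reach :: "nat \<Rightarrow> input \<Rightarrow> bool" where
  "almost_sure_reach d (A, c, qF) =
     almost_sure (induced_mdp d (vass_of A)) c (reach d (vass_of A) qF)"

fun limit_sure_reach :: "nat \<Rightarrow> input \<Rightarrow> bool" where
  "limit_sure_reach d (A, c, qF) =
     limit_sure (induced_mdp d (vass_of A)) c (reach d (vass_of A) qF)"

fun almost_sure_repeated_reach :: "nat \<Rightarrow> input \<Rightarrow> bool" where
  "almost_sure_repeated_reach d (A, c, qF) =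
     almost_sure (induced_mdp d (vass_of A)) c (repeated_reach d (vass_of A) qF)"

fun limit_sure_repeated_reach :: "nat \<Rightarrow> input \<Rightarrow> bool" where
  "limit_sure_repeated_reach d (A, c, qF) =
     limit_sure (induced_mdp d (vass_of A)) c (repeated_reach d (vass_of A) qF)"

end

theory Submission
  imports Defs "HOL-Computational_Algebra.Primes" "HOL-Library.Infinite_Set"
begin

text \<open>A two-counter machine is simulated by a game in which Player 1 only claims, for each
  instruction, whether it is enabled, and the probabilistic states then change the counters. A false
  claim that it is enabled blocks the play for ever; a false claim that it is disabled is punished
  with probability at least \<open>1/2\<close>, since the disabled transition becomes possible. If the
  machine halts, honest claims reach the halting state almost surely: an exponential in the number of
  remaining machine steps is a supermartingale with contraction factor \<open>3/4\<close>. If it does not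
  halt, some claim must be false, and a supermartingale that equals \<open>1/2\<close> on the honest plays
  bounds the probability of reaching the halting state by \<open>1/2\<close> for every strategy. As the
  halting state is absorbing, all four problems have the same answer, namely whether the machine
  halts. A partial recursive decision procedure could be compiled, via register programs and
  Goedel numbering of the registers by prime powers, to a two-counter machine that runs the procedure
  on its own VASS-MDP and halts iff the answer is negative.\<close>

section \<open>Partial recursive functions\<close>

text \<open>A VASS has no zero test, and in a P-VASS-MDP Player 1 cannot change the counters, so a
  claim can only be checked by what chance is able to do: a disabled transition never fires, an
  enabled one fires with positive probability. After the claim "enabled" the instruction itself
  should follow, but deadlock-freedom demands an alternative in case it is not enabled; this is the
  loop at \<open>3 * l + 1\<close>. Its price is that the honest simulation of one machine step
  takes a random time, so halting is reached only almost surely, and the value function has to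
  contract even while the play waits in that loop. Since the winning probability is either attained
  as \<open>1\<close> or bounded by \<open>1/2\<close>, the limit-sure problems are settled together
  with the almost-sure ones. A machine with only two counters needs its data as a Goedel number; no
  conversion from plain data arises, because the initial counter value belongs to the problem
  instance and may be chosen to be that number.\<close>

lemma computes_Proj: "i < length xs \<Longrightarrow> xs ! i = y \<Longrightarrow> computes (Proj i) xs y"
  using computes.intros(3) by blast

lemma computes_Comp1: "computes g xs y \<Longrightarrow> computes f [y] z \<Longrightarrow> computes (Comp f [g]) xs z"
  by (rule computes.intros(4)) auto

lemma computes_Comp2:
  "computes g xs y \<Longrightarrow> computes g' xs y' \<Longrightarrow> computes f [y, y'] z \<Longrightarrow> computes (Comp f [g, g']) xs z"
  by (rule computes.intros(4)) auto

definition recf_add :: recf where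
  "recf_add = PrimRec (Proj 0) (Comp Succ [Proj 1])"

lemma computes_add: "computes recf_add [m, n] (m + n)"
  unfolding recf_add_def
  by (induction m) (auto intro!: computes.intros(5,6) computes_Proj computes_Comp1 computes.intros(2))

section \<open>Codes of lists are computable from the codes of their parts\<close>

definition recf_triangle :: recf where
  "recf_triangle = PrimRec Zero (Comp Succ [Comp recf_add [Proj 1, Proj 0]])"

lemma computes_triangle: "computes recf_triangle [n] (triangle n)"
proof (induction n)
  case 0
  show ?case unfolding recf_triangle_def by (simp add: computes.intros)
next
  case (Suc n)
  have "computes (Comp Succ [Comp recf_add [Proj 1, Proj 0]]) [n, triangle n] (Suc (triangle n + n))"
    by (rule computes_Comp1 computes_Comp2 computes_Proj computes_add computes.intros(2) | simp)+
  with Suc show ?case unfolding recf_triangle_def by (simp add: computes.intros)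
qed

text \<open>Cantor's pairing is \<open>triangle (x + l) + x\<close>, with \<open>l\<close> the code
  of the tail, and \<open>list_encode\<close> adds \<open>Suc\<close>. Only the code of the tail is
  used, so a list can be extended without ever being decoded.\<close>

definition recf_cons :: recf where
  "recf_cons = Comp Succ [Comp recf_add [Comp recf_triangle [recf_add], Proj 0]]"

lemma computes_cons: "computes recf_cons [x, list_encode xs] (list_encode (x # xs))"
  unfolding recf_cons_def list_encode.simps prod_encode_def prod.case
  by (rule computes_Comp1 computes_Comp2 computes_Proj computes_add computes_triangle
      computes.intros(2) | simp)+

fun recf_list :: "recf list \<Rightarrow> recf" where
  "recf_list [] = Zero"
| "recf_list (g # gs) = Comp recf_cons [g, recf_list gs]"

lemma computes_list:
  "list_all2 (\<lambda>g y. computes g xs y) gs ys \<Longrightarrow> computes (recf_list gs) xs (list_encode ys)"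
proof (induction gs ys rule: list_all2_induct)
  case Nil
  show ?case by (simp add: computes.intros)
next
  case (Cons g gs y ys)
  then show ?case
    by (simp only: recf_list.simps) (blast intro: computes_Comp2 computes_cons)
qed

primrec recf_const :: "nat \<Rightarrow> recf" where
  "recf_const 0 = Zero"
| "recf_const (Suc n) = Comp Succ [recf_const n]"

lemma computes_const: "computes (recf_const n) xs n"
  by (induction n) (auto intro: computes.intros computes_Comp1)

definition recf_mult :: recf where
  "recf_mult = PrimRec Zero (Comp recf_add [Proj 2, Proj 1])"

lemma computes_mult: "computes recf_mult [m, n] (m * n)"
proof (induction m)
  case 0
  show ?case unfolding recf_mult_def by (simp add: computes.intros)
next
  case (Suc m)
  have "computes (Comp recf_add [Proj 2, Proj 1]) [m, m * n, n] (n + m * n)"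
    by (rule computes_Comp2 computes_Proj computes_add | simp)+
  with Suc show ?case unfolding recf_mult_def by (simp add: computes.intros)
qed

definition recf_power :: "nat \<Rightarrow> recf" where
  "recf_power p = PrimRec (recf_const 1) (Comp recf_mult [recf_const p, Proj 1])"

lemma computes_power: "computes (recf_power p) [n] (p ^ n)"
proof (induction n)
  case 0
  show ?case unfolding recf_power_def by (auto intro: computes.intros computes_const[of 1, simplified])
next
  case (Suc n)
  have "computes (Comp recf_mult [recf_const p, Proj 1]) [n, p ^ n] (p * p ^ n)"
    by (rule computes_Comp2 computes_Proj computes_mult computes_const | simp)+
  with Suc show ?case unfolding recf_power_def by (simp add: computes.intros)
qed

text \<open>The rules for \<open>PrimRec\<close> call the same term again, whereas
  \<open>compile_correct\<close> is by induction on the term. Unrolling the recursion into its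
  values \<open>ys\<close> leaves only calls of the subterms \<open>f\<close> and
  \<open>g\<close>.\<close>

lemma computes_PrimRecE:
  assumes "computes (PrimRec f g) xs y"
  obtains n xs' ys where "xs = n # xs'" "computes f xs' (ys 0)"
    "\<And>i. i < n \<Longrightarrow> computes g (i # ys i # xs') (ys (Suc i))" "ys n = y"
proof -
  have "\<exists>n xs' ys. xs = n # xs' \<and> computes f xs' (ys 0) \<and>
      (\<forall>i<n. computes g (i # ys i # xs') (ys (Suc i))) \<and> ys n = y"
    using assms
  proof (induction "PrimRec f g" xs y rule: computes.induct)
    case (5 xs y)
    then show ?case by (intro exI[of _ 0] exI[of _ xs] exI[of _ "\<lambda>_. y"]) auto
  next
    case (6 n xs y z)
    then obtain ys where ys: "computes f xs (ys 0)"
      "\<forall>i<n. computes g (i # ys i # xs) (ys (Suc i))" "ys n = y" by auto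
    with 6 show ?case
      by (intro exI[of _ "Suc n"] exI[of _ xs] exI[of _ "ys(Suc n := z)"]) (auto simp: less_Suc_eq)
  qed
  with that show thesis by blast
qed

section \<open>Structured register programs\<close>

text \<open>\<open>Loop\<close> is a while loop that decrements its register before each round, and
  its body may refill that register. This yields minimisation as well as primitive recursion, and
  test plus decrement becomes a single division once registers are exponents of primes.\<close>

datatype com = Skip | Inc nat | Seq com com | Loop nat com

inductive exec :: "com \<Rightarrow> (nat \<Rightarrow> nat) \<Rightarrow> (nat \<Rightarrow> nat) \<Rightarrow> bool" where
  exec_Skip: "exec Skip s s"
| exec_Inc: "exec (Inc r) s (s(r := Suc (s r)))"
| exec_Seq: "exec c s s' \<Longrightarrow> exec c' s' s'' \<Longrightarrow> exec (Seq c c') s s''"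
| exec_Loop_0: "s r = 0 \<Longrightarrow> exec (Loop r c) s s"
| exec_Loop_Suc: "s r = Suc n \<Longrightarrow> exec c (s(r := n)) s' \<Longrightarrow> exec (Loop r c) s' s'' \<Longrightarrow>
    exec (Loop r c) s s''"

definition clear :: "nat \<Rightarrow> com" where
  "clear r = Loop r Skip"

lemma exec_clear: "exec (clear r) s (s(r := 0))"
proof (induction "s r" arbitrary: s)
  case 0
  then have "s(r := 0) = s" by auto
  with 0 show ?case unfolding clear_def by (metis exec_Loop_0)
next
  case (Suc n)
  from Suc(1)[of "s(r := n)"] have "exec (Loop r Skip) (s(r := n)) (s(r := 0))"
    by (simp add: clear_def)
  with Suc(2) show ?case unfolding clear_def by (metis exec_Loop_Suc exec_Skip)
qed

text \<open>Moving with \<open>Loop\<close> destroys the source, so \<open>t\<close> collects a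
  second copy from which the source is refilled. Working registers hold arbitrary values, hence the
  initial clearing.\<close>

definition copy :: "nat \<Rightarrow> nat \<Rightarrow> nat \<Rightarrow> com" where
  "copy r d t = Seq (clear d) (Seq (clear t)
     (Seq (Loop r (Seq (Inc d) (Inc t))) (Loop t (Inc r))))"

lemma exec_transfer2:
  assumes "r \<noteq> d" "r \<noteq> t" "d \<noteq> t"
  shows "exec (Loop r (Seq (Inc d) (Inc t))) s (s(r := 0, d := s d + s r, t := s t + s r))"
proof (induction "s r" arbitrary: s)
  case 0
  then have "s(r := 0, d := s d + s r, t := s t + s r) = s" by auto
  with 0 show ?case by (metis exec_Loop_0)
next
  case (Suc n)
  let ?s = "s(r := n, d := Suc (s d), t := Suc (s t))"
  from assms have 1: "exec (Seq (Inc d) (Inc t)) (s(r := n)) ?s"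
    by (intro exec_Seq[of _ _ "s(r := n, d := Suc (s d))"])
      (metis exec_Inc fun_upd_apply)+
  from Suc(1)[of ?s] assms
  have "exec (Loop r (Seq (Inc d) (Inc t))) ?s (?s(r := 0, d := Suc (s d) + n, t := Suc (s t) + n))"
    by simp
  also have "?s(r := 0, d := Suc (s d) + n, t := Suc (s t) + n) =
      s(r := 0, d := s d + s r, t := s t + s r)"
    using Suc(2)[symmetric] assms by (auto simp: fun_eq_iff)
  finally show ?case using exec_Loop_Suc[OF Suc(2)[symmetric] 1] by blast
qed

lemma exec_transfer:
  assumes "r \<noteq> t"
  shows "exec (Loop t (Inc r)) s (s(t := 0, r := s r + s t))"
proof (induction "s t" arbitrary: s)
  case 0
  then have "s(t := 0, r := s r + s t) = s" by auto
  with 0 show ?case by (metis exec_Loop_0)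
next
  case (Suc n)
  let ?s = "s(t := n, r := Suc (s r))"
  from assms have 1: "exec (Inc r) (s(t := n)) ?s"
    by (metis exec_Inc fun_upd_apply)
  from Suc(1)[of ?s] assms
  have "exec (Loop t (Inc r)) ?s (?s(t := 0, r := Suc (s r) + n))"
    by simp
  also have "?s(t := 0, r := Suc (s r) + n) = s(t := 0, r := s r + s t)"
    using Suc(2)[symmetric] assms by (auto simp: fun_eq_iff)
  finally show ?case using exec_Loop_Suc[OF Suc(2)[symmetric] 1] by blast
qed

lemma exec_copy:
  assumes "r \<noteq> d" "r \<noteq> t" "d \<noteq> t"
  shows "exec (copy r d t) s (s(d := s r, t := 0))"
proof -
  let ?s1 = "s(d := 0)" and ?s2 = "s(d := 0, t := 0)" and ?s3 = "s(d := s r, t := s r, r := 0)"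
  have 3: "exec (Loop r (Seq (Inc d) (Inc t))) ?s2 ?s3"
    using exec_transfer2[OF assms, of ?s2] assms by (auto simp: fun_upd_twist)
  have "?s3(t := 0, r := s r) = s(d := s r, t := 0)"
    using assms by (auto simp: fun_eq_iff)
  with exec_transfer[OF assms(2), of ?s3] assms
  have 4: "exec (Loop t (Inc r)) ?s3 (s(d := s r, t := 0))" by simp
  show ?thesis unfolding copy_def
    by (rule exec_Seq[OF exec_clear exec_Seq[OF exec_clear exec_Seq[OF 3 4]]])
qed

section \<open>Compilation of recursive functions to register programs\<close>

text \<open>It takes compiled functions instead of terms, so that \<open>compile\<close> remains
  primitive recursive through the argument list of \<open>Comp\<close>.\<close>

primrec compile_args :: "(nat list \<Rightarrow> nat \<Rightarrow> nat \<Rightarrow> com) list \<Rightarrow> nat list \<Rightarrow> nat \<Rightarrow> nat \<Rightarrow> com" where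
  "compile_args [] rs j k = Skip"
| "compile_args (c # cs) rs j k = Seq (c rs j k) (compile_args cs rs (Suc j) k)"

text \<open>In \<open>compile f rs d k\<close> the arguments are read from the registers \<open>rs\<close>, the result is written
  to \<open>d\<close>, and the registers from \<open>k\<close> on are available as working space with arbitrary contents.\<close>

primrec compile :: "recf \<Rightarrow> nat list \<Rightarrow> nat \<Rightarrow> nat \<Rightarrow> com" where
  "compile Zero = (\<lambda>rs d k. clear d)"
| "compile Succ = (\<lambda>rs d k. Seq (copy (hd rs) d k) (Inc d))"
| "compile (Proj i) = (\<lambda>rs d k. copy (rs ! i) d k)"
| "compile (Comp f gs) = (\<lambda>rs d k.
     Seq (compile_args (map compile gs) rs k (k + length gs))
       (compile f [k..<k + length gs] d (k + length gs)))"
| "compile (PrimRec f g) = (\<lambda>rs d k.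
     Seq (copy (hd rs) k (k + 4)) (Seq (clear (k + 1)) (Seq (compile f (tl rs) (k + 2) (k + 4))
       (Seq (Loop k (Seq (compile g ((k + 1) # (k + 2) # tl rs) (k + 3) (k + 4))
              (Seq (copy (k + 3) (k + 2) (k + 4)) (Inc (k + 1)))))
         (copy (k + 2) d (k + 4))))))"
| "compile (Mu f) = (\<lambda>rs d k.
     Seq (clear k) (Seq (compile f (k # rs) (k + 1) (k + 2))
       (Seq (Loop (k + 1) (Seq (Inc k) (compile f (k # rs) (k + 1) (k + 2))))
         (copy k d (k + 2)))))"

text \<open>The quantification over \<open>rs\<close>, \<open>d\<close> and \<open>k\<close> lets a
  subprogram be placed above all registers of its caller. The frame condition stops at
  \<open>k\<close>, and nothing is assumed about the contents beyond.\<close>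

definition implements :: "(nat list \<Rightarrow> nat \<Rightarrow> nat \<Rightarrow> com) \<Rightarrow> nat list \<Rightarrow> nat \<Rightarrow> bool" where
  "implements c xs y \<longleftrightarrow> (\<forall>s rs d k. map s rs = xs \<longrightarrow> set rs \<subseteq> {..<k} \<longrightarrow> d < k \<longrightarrow> d \<notin> set rs \<longrightarrow>
     (\<exists>s'. exec (c rs d k) s s' \<and> s' d = y \<and> (\<forall>r<k. r \<noteq> d \<longrightarrow> s' r = s r)))"

lemma implementsD:
  assumes "implements c xs y" "map s rs = xs" "set rs \<subseteq> {..<k}" "d < k" "d \<notin> set rs"
  obtains s' where "exec (c rs d k) s s'" "s' d = y" "\<And>r. r < k \<Longrightarrow> r \<noteq> d \<Longrightarrow> s' r = s r"
  using assms unfolding implements_def by blast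

text \<open>The results go to consecutive registers from \<open>j\<close> on, while every subprogram
  works from \<open>k\<close> on, beyond all of them; thus no later subprogram destroys an earlier
  result.\<close>

lemma compile_args_correct:
  assumes "list_all2 (\<lambda>c y. implements c xs y) cs ys" "map s rs = xs" "set rs \<subseteq> {..<j}"
    "j + length cs \<le> k"
  shows "\<exists>s'. exec (compile_args cs rs j k) s s' \<and> map s' [j..<j + length cs] = ys \<and>
    (\<forall>r<j. s' r = s r)"
  using assms
proof (induction cs ys arbitrary: s j rule: list_all2_induct)
  case Nil
  then show ?case by (auto intro: exec_Skip)
next
  case (Cons c cs y ys)
  obtain s1 where s1: "exec (c rs j k) s s1" "s1 j = y" "\<And>r. r < k \<Longrightarrow> r \<noteq> j \<Longrightarrow> s1 r = s r"
    by (rule implementsD[OF Cons(1) Cons(4), of k j]) (use Cons in auto)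
  have "map s1 rs = xs"
    using Cons(4) by (rule trans[rotated]) (use Cons(5,6) s1(3) in \<open>fastforce intro!: map_cong\<close>)
  then obtain s2 where s2: "exec (compile_args cs rs (Suc j) k) s1 s2"
    "map s2 [Suc j..<Suc j + length cs] = ys" "\<forall>r<Suc j. s2 r = s1 r"
    using Cons(3)[of s1 "Suc j"] Cons(5,6) by fastforce
  have "map s2 [j..<j + length (c # cs)] = y # ys"
    using s2 s1 by (simp add: upt_conv_Cons del: upt_Suc)
  moreover have "\<forall>r<j. s2 r = s r" using s1 s2 Cons(6) by simp
  ultimately show ?case
    using exec_Seq[OF s1(1) s2(1)] by auto
qed

lemma compile_Comp:
  assumes "list_all2 (\<lambda>g y. implements (compile g) xs y) gs ys" "implements (compile f) ys z"
  shows "implements (compile (Comp f gs)) xs z"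
  unfolding implements_def
proof (intro allI impI)
  fix s :: "nat \<Rightarrow> nat" and rs d k
  assume A: "map s rs = xs" "set rs \<subseteq> {..<k}" "d < k" "d \<notin> set rs"
  have "list_all2 (\<lambda>c y. implements c xs y) (map compile gs) ys"
    using assms(1) by (simp add: list.rel_map)
  from compile_args_correct[OF this A(1,2), of "k + length gs"]
  obtain s1 where s1: "exec (compile_args (map compile gs) rs k (k + length gs)) s s1"
    "map s1 [k..<k + length gs] = ys" "\<forall>r<k. s1 r = s r" by auto
  obtain s2 where s2: "exec (compile f [k..<k + length gs] d (k + length gs)) s1 s2" "s2 d = z"
    "\<And>r. r < k + length gs \<Longrightarrow> r \<noteq> d \<Longrightarrow> s2 r = s1 r"
    by (rule implementsD[OF assms(2) s1(2), of "k + length gs" d]) (use A in auto)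
  show "\<exists>s'. exec (compile (Comp f gs) rs d k) s s' \<and> s' d = z \<and> (\<forall>r<k. r \<noteq> d \<longrightarrow> s' r = s r)"
    using exec_Seq[OF s1(1) s2(1)] s1 s2 by auto
qed

text \<open>Layout: \<open>k\<close> counts the remaining rounds, \<open>k + 1\<close> is the
  recursion index, \<open>k + 2\<close> the current value, \<open>k + 3\<close> the fresh result of
  \<open>g\<close>, and subprograms work from \<open>k + 4\<close> on. With \<open>m\<close> rounds
  left, index and value are \<open>n - m\<close> and \<open>ys (n - m)\<close>.\<close>

lemma compile_PrimRec:
  assumes "implements (compile f) xs (ys 0)"
    "\<And>i. i < n \<Longrightarrow> implements (compile g) (i # ys i # xs) (ys (Suc i))"
  shows "implements (compile (PrimRec f g)) (n # xs) (ys n)"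
  unfolding implements_def
proof (intro allI impI)
  fix s :: "nat \<Rightarrow> nat" and rs d k
  assume A: "map s rs = n # xs" "set rs \<subseteq> {..<k}" "d < k" "d \<notin> set rs"
  then obtain r0 rt where rs: "rs = r0 # rt" "s r0 = n" "map s rt = xs" by (cases rs) auto
  have rt: "map s' rt = xs" if "\<forall>r<k. s' r = s r" for s'
    unfolding rs(3)[symmetric] using that A(2) rs(1) by (intro map_cong) auto
  let ?body = "Seq (compile g ((k + 1) # (k + 2) # rt) (k + 3) (k + 4))
     (Seq (copy (k + 3) (k + 2) (k + 4)) (Inc (k + 1)))"
  have loop: "\<exists>s'. exec (Loop k ?body) s1 s' \<and> s' (k + 2) = ys n \<and> (\<forall>r<k. s' r = s r)"
    if "s1 k = m" "s1 (k + 1) = n - m" "m \<le> n" "s1 (k + 2) = ys (n - m)" "\<forall>r<k. s1 r = s r" for m s1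
    using that
  proof (induction m arbitrary: s1)
    case 0
    then show ?case by (auto intro: exec_Loop_0)
  next
    case (Suc m)
    let ?i = "n - Suc m" and ?s1 = "s1(k := m)"
    have i: "?i < n" "Suc ?i = n - m" using Suc.prems by auto
    have "map ?s1 ((k + 1) # (k + 2) # rt) = ?i # ys ?i # xs"
      using Suc.prems rt[of ?s1] by simp
    then obtain s2 where s2: "exec (compile g ((k + 1) # (k + 2) # rt) (k + 3) (k + 4)) ?s1 s2"
      "s2 (k + 3) = ys (n - m)" "\<And>r. r < k + 4 \<Longrightarrow> r \<noteq> k + 3 \<Longrightarrow> s2 r = ?s1 r"
      by (rule implementsD[OF assms(2)[OF i(1)], of ?s1 "(k + 1) # (k + 2) # rt" "k + 4" "k + 3"])
        (use A rs i in auto)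
    let ?s3 = "s2(k + 2 := s2 (k + 3), k + 4 := 0)"
    let ?s4 = "?s3(k + 1 := Suc (?s3 (k + 1)))"
    have "exec (copy (k + 3) (k + 2) (k + 4)) s2 ?s3" by (rule exec_copy) auto
    from exec_Seq[OF s2(1) exec_Seq[OF this exec_Inc[of "k + 1"]]]
    have body: "exec ?body ?s1 ?s4" .
    have "\<exists>s'. exec (Loop k ?body) ?s4 s' \<and> s' (k + 2) = ys n \<and> (\<forall>r<k. s' r = s r)"
      by (rule Suc.IH) (use Suc.prems s2 i in auto)
    with exec_Loop_Suc[OF Suc.prems(1) body] show ?case by blast
  qed
  let ?s1 = "s(k := n, k + 4 := 0)" and ?s2 = "s(k := n, k + 4 := 0, k + 1 := 0)"
  have 1: "exec (copy r0 k (k + 4)) s ?s1"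
    using exec_copy[of r0 k "k + 4" s] A rs by auto
  have "map ?s2 rt = xs" by (rule rt) auto
  then obtain s3 where s3: "exec (compile f rt (k + 2) (k + 4)) ?s2 s3" "s3 (k + 2) = ys 0"
    "\<And>r. r < k + 4 \<Longrightarrow> r \<noteq> k + 2 \<Longrightarrow> s3 r = ?s2 r"
    by (rule implementsD[OF assms(1), of ?s2 rt "k + 4" "k + 2"]) (use A rs in auto)
  from loop[of s3 n] s3 obtain s4 where s4: "exec (Loop k ?body) s3 s4" "s4 (k + 2) = ys n"
    "\<forall>r<k. s4 r = s r" by auto
  have 5: "exec (copy (k + 2) d (k + 4)) s4 (s4(d := s4 (k + 2), k + 4 := 0))"
    by (rule exec_copy) (use A in auto)
  from exec_Seq[OF 1 exec_Seq[OF exec_clear exec_Seq[OF s3(1) exec_Seq[OF s4(1) 5]]]]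
  have "exec (compile (PrimRec f g) rs d k) s (s4(d := s4 (k + 2), k + 4 := 0))"
    by (simp add: rs)
  then show "\<exists>s'. exec (compile (PrimRec f g) rs d k) s s' \<and> s' d = ys n \<and>
      (\<forall>r<k. r \<noteq> d \<longrightarrow> s' r = s r)"
    by (intro exI conjI, assumption) (use s4 A in auto)
qed

text \<open>Register \<open>k\<close> is the candidate and \<open>k + 1\<close> the value of
  \<open>f\<close> there, which also controls the loop. That the loop decrements it is harmless,
  because the body recomputes it for the next candidate.\<close>

lemma compile_Mu:
  assumes "implements (compile f) (n # xs) 0"
    "\<And>i. i < n \<Longrightarrow> \<exists>y>0. implements (compile f) (i # xs) y"
  shows "implements (compile (Mu f)) xs n"
  unfolding implements_def
proof (intro allI impI)
  fix s :: "nat \<Rightarrow> nat" and rs d k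
  assume A: "map s rs = xs" "set rs \<subseteq> {..<k}" "d < k" "d \<notin> set rs"
  let ?c = "compile f (k # rs) (k + 1) (k + 2)"
  have run: "\<exists>s2. exec ?c s1 s2 \<and> s2 k = i \<and> s2 (k + 1) = y \<and> (\<forall>r<k. s2 r = s r)"
    if s1: "s1 k = i" "\<forall>r<k. s1 r = s r" "implements (compile f) (i # xs) y" for s1 i y
  proof -
    have "map s1 rs = xs" unfolding A(1)[symmetric] using s1 A(2) by (intro map_cong) auto
    then have "map s1 (k # rs) = i # xs" using s1 by simp
    then obtain s2 where "exec ?c s1 s2" "s2 (k + 1) = y"
      "\<And>r. r < k + 2 \<Longrightarrow> r \<noteq> k + 1 \<Longrightarrow> s2 r = s1 r"
      by (rule implementsD[OF s1(3), of s1 "k # rs" "k + 2" "k + 1"]) (use A in auto)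
    with s1 show ?thesis by (intro exI[of _ s2]) auto
  qed
  let ?good = "\<lambda>s1 i. s1 k = i \<and> (\<forall>r<k. s1 r = s r) \<and> i \<le> n \<and>
     (i < n \<longrightarrow> s1 (k + 1) > 0) \<and> (i = n \<longrightarrow> s1 (k + 1) = 0)"
  have next_good: "\<exists>s2. exec ?c s1 s2 \<and> ?good s2 i"
    if "s1 k = i" "\<forall>r<k. s1 r = s r" "i \<le> n" for s1 i
  proof (cases "i = n")
    case True
    with run[of s1 i 0] that assms(1) show ?thesis by auto
  next
    case False
    with that assms(2)[of i] obtain y where "y > 0" "implements (compile f) (i # xs) y" by auto
    with run[OF that(1,2)] False that show ?thesis by fastforce
  qed
  have loop: "\<exists>s'. exec (Loop (k + 1) (Seq (Inc k) ?c)) s1 s' \<and> s' k = n \<and> (\<forall>r<k. s' r = s r)"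
    if "?good s1 i" for s1 i
    using that
  proof (induction "n - i" arbitrary: s1 i)
    case 0
    then show ?case by (intro exI[of _ s1]) (auto intro: exec_Loop_0)
  next
    case (Suc m)
    then obtain y where y: "s1 (k + 1) = Suc y" by (metis gr0_implies_Suc zero_less_Suc zero_less_diff)
    let ?s2 = "(s1(k + 1 := y))(k := Suc ((s1(k + 1 := y)) k))"
    from next_good[of ?s2 "Suc i"] Suc obtain s3 where s3: "exec ?c ?s2 s3" "?good s3 (Suc i)" by auto
    have "\<exists>s'. exec (Loop (k + 1) (Seq (Inc k) ?c)) s3 s' \<and> s' k = n \<and> (\<forall>r<k. s' r = s r)"
      by (rule Suc(1)[of "Suc i"]) (use Suc s3 in auto)
    with exec_Loop_Suc[where s = s1, OF y exec_Seq[OF exec_Inc s3(1)]] show ?case by blast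
  qed
  from next_good[of "s(k := 0)" 0] obtain s1 where s1: "exec ?c (s(k := 0)) s1" "?good s1 0" by auto
  from loop[OF s1(2)] obtain s2 where s2: "exec (Loop (k + 1) (Seq (Inc k) ?c)) s1 s2"
    "s2 k = n" "\<forall>r<k. s2 r = s r" by blast
  have 3: "exec (copy k d (k + 2)) s2 (s2(d := s2 k, k + 2 := 0))"
    by (rule exec_copy) (use A in auto)
  from exec_Seq[OF exec_clear exec_Seq[OF s1(1) exec_Seq[OF s2(1) 3]]]
  have "exec (compile (Mu f) rs d k) s (s2(d := s2 k, k + 2 := 0))" by simp
  then show "\<exists>s'. exec (compile (Mu f) rs d k) s s' \<and> s' d = n \<and> (\<forall>r<k. r \<noteq> d \<longrightarrow> s' r = s r)"
    by (intro exI conjI, assumption) (use s2 A in auto)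
qed

lemma compile_correct: "computes f xs y \<Longrightarrow> implements (compile f) xs y"
proof (induction f arbitrary: xs y)
  case Zero
  then have "y = 0" by (auto elim: computes.cases)
  moreover have "exec (clear d) s (s(d := 0))" for d s by (rule exec_clear)
  ultimately show ?case unfolding implements_def by (metis compile.simps(1) fun_upd_apply)
next
  case Succ
  then obtain x xs' where xs: "xs = x # xs'" "y = Suc x" by (auto elim: computes.cases)
  show ?case unfolding implements_def
  proof (intro allI impI)
    fix s :: "nat \<Rightarrow> nat" and rs d k
    assume A: "map s rs = xs" "set rs \<subseteq> {..<k}" "d < k" "d \<notin> set rs"
    then have hd: "hd rs \<in> set rs" "s (hd rs) = x" using xs by (cases rs; auto)+
    have "exec (copy (hd rs) d k) s (s(d := s (hd rs), k := 0))"
      by (rule exec_copy) (use A hd in auto)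
    from exec_Seq[OF this exec_Inc[of d]]
    show "\<exists>s'. exec (compile Succ rs d k) s s' \<and> s' d = y \<and> (\<forall>r<k. r \<noteq> d \<longrightarrow> s' r = s r)"
      unfolding compile.simps by (intro exI conjI, assumption) (use A hd xs in auto)
  qed
next
  case (Proj i)
  then have xs: "i < length xs" "y = xs ! i" by (auto elim: computes.cases)
  show ?case unfolding implements_def
  proof (intro allI impI)
    fix s :: "nat \<Rightarrow> nat" and rs d k
    assume A: "map s rs = xs" "set rs \<subseteq> {..<k}" "d < k" "d \<notin> set rs"
    then have i: "rs ! i \<in> set rs" "s (rs ! i) = y" using xs by (auto simp: in_set_conv_nth)
    have "exec (copy (rs ! i) d k) s (s(d := s (rs ! i), k := 0))"
      by (rule exec_copy) (use A i in auto)
    then show "\<exists>s'. exec (compile (Proj i) rs d k) s s' \<and> s' d = y \<and> (\<forall>r<k. r \<noteq> d \<longrightarrow> s' r = s r)"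
      unfolding compile.simps by (intro exI conjI, assumption) (use A i in auto)
  qed
next
  case (Comp f gs)
  from Comp.prems obtain ys where "list_all2 (\<lambda>g y. computes g xs y) gs ys" "computes f ys y"
    by (auto elim: computes.cases)
  moreover from this(1) have "list_all2 (\<lambda>g y. implements (compile g) xs y) gs ys"
    by (rule list.rel_mono_strong) (use Comp.IH in auto)
  ultimately show ?case using compile_Comp Comp.IH by blast
next
  case (PrimRec f g)
  obtain n xs' ys where *: "xs = n # xs'" "computes f xs' (ys 0)"
    "\<And>i. i < n \<Longrightarrow> computes g (i # ys i # xs') (ys (Suc i))" "ys n = y"
    by (rule computes_PrimRecE[OF PrimRec.prems]) (rule that)
  with compile_PrimRec[of f xs' ys n g] PrimRec.IH show ?case by blast
next
  case (Mu f)
  from Mu.prems have "computes f (y # xs) 0" "\<forall>i<y. \<exists>z>0. computes f (i # xs) z"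
    by (auto elim: computes.cases)
  with Mu.IH show ?case by (intro compile_Mu) blast+
qed

section \<open>Two-counter machines\<close>

text \<open>A vector addition guarded by nonnegativity, with a second target for the disabled case:
  the guard is exactly the enabledness of a VASS transition. A zero test is a failed decrement, and
  arbitrary entries allow multiplication by a prime in a loop of one instruction.\<close>

type_synonym instr = "int \<times> int \<times> nat \<times> nat"
type_synonym mconf = "nat \<times> nat \<times> nat"

fun mstep :: "(nat \<Rightarrow> instr) \<Rightarrow> mconf \<Rightarrow> mconf" where
  "mstep P (l, x, y) = (case P l of (a, b, l1, l2) \<Rightarrow>
     if 0 \<le> int x + a \<and> 0 \<le> int y + b then (l1, nat (int x + a), nat (int y + b)) else (l2, x, y))"

definition reaches :: "(nat \<Rightarrow> instr) \<Rightarrow> mconf \<Rightarrow> mconf \<Rightarrow> bool" where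
  "reaches P c c' \<longleftrightarrow> (\<exists>t. (mstep P ^^ t) c = c')"

lemma reaches_refl: "reaches P c c"
  unfolding reaches_def by (rule exI[of _ 0]) simp

lemma reaches_trans: "reaches P c c' \<Longrightarrow> reaches P c' c'' \<Longrightarrow> reaches P c c''"
  unfolding reaches_def by (auto simp flip: funpow_add[THEN fun_cong, unfolded o_apply])

lemma reaches_step: "mstep P c = c' \<Longrightarrow> reaches P c c'"
  unfolding reaches_def by (rule exI[of _ 1]) simp

lemma reaches_Cons: "mstep P c = c' \<Longrightarrow> reaches P c' c'' \<Longrightarrow> reaches P c c''"
  using reaches_step reaches_trans by blast

lemma funpow_fixed: "f c = c \<Longrightarrow> (f ^^ n) c = c"
  by (induction n) auto

text \<open>By determinism the run is at both fixed points after \<open>s + t\<close> steps.\<close>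

lemma reaches_fixed_unique:
  assumes "reaches P c a" "reaches P c b" "mstep P a = a" "mstep P b = b"
  shows "a = b"
proof -
  obtain s t where st: "(mstep P ^^ s) c = a" "(mstep P ^^ t) c = b"
    using assms(1,2) unfolding reaches_def by blast
  have "(mstep P ^^ (s + t)) c = b" "(mstep P ^^ (t + s)) c = a"
    using st assms(3,4) by (simp_all add: funpow_add funpow_fixed)
  then show ?thesis by (simp add: add.commute)
qed

definition code_at :: "(nat \<Rightarrow> instr) \<Rightarrow> nat \<Rightarrow> instr list \<Rightarrow> bool" where
  "code_at P k is \<longleftrightarrow> (\<forall>i<length is. P (k + i) = is ! i)"

lemma code_at_Nil [simp]: "code_at P k []"
  by (simp add: code_at_def)

lemma code_at_Cons [simp]: "code_at P k (i # is) \<longleftrightarrow> P k = i \<and> code_at P (Suc k) is"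
  by (auto simp: code_at_def less_Suc_eq_0_disj)

lemma code_at_append [simp]:
  "code_at P k (is @ js) \<longleftrightarrow> code_at P k is \<and> code_at P (k + length is) js"
  by (induction "is" arbitrary: k) auto

text \<open>Incrementing a register multiplies the Goedel number by its prime: the first instruction
  empties the first counter into the second, adding \<open>p\<close> per unit, and the second
  instruction moves the result back.\<close>

definition inc_code :: "nat \<Rightarrow> nat \<Rightarrow> nat \<Rightarrow> instr list" where
  "inc_code p k e = [(- 1, int p, k, k + 1), (1, - 1, k + 1, e)]"

text \<open>Division of the first counter by \<open>p\<close>: the quotient is collected in the second
  counter; if the remainder is not \<open>0\<close>, the original value is restored.\<close>

definition dec_code :: "nat \<Rightarrow> nat \<Rightarrow> nat \<Rightarrow> nat \<Rightarrow> instr list" where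
  "dec_code p k yes no =
     [(- int p, 1, k, k + 1), (- 1, 0, k + 3, k + 2), (1, - 1, k + 2, yes),
      (1, 0, k + 4, k + 4), (int p, - 1, k + 4, no)]"

lemma length_dec_code [simp]: "length (dec_code p k yes no) = 5"
  by (simp add: dec_code_def)

lemma reaches_move_left:
  assumes "P k = (int p, - 1, k, e)"
  shows "reaches P (k, x, y) (e, x + p * y, 0)"
proof (induction y arbitrary: x)
  case 0
  then show ?case using assms by (intro reaches_step) auto
next
  case (Suc y)
  have "mstep P (k, x, Suc y) = (k, x + p, y)" using assms by (simp add: nat_int_add)
  then show ?case using Suc[of "x + p"] by (auto intro: reaches_Cons simp: algebra_simps)
qed

lemma reaches_inc_code:
  assumes "code_at P k (inc_code p k e)"
  shows "reaches P (k, x, 0) (e, p * x, 0)"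
proof -
  \<comment> \<open>Writing \<open>int 1\<close> makes \<open>reaches_move_left\<close> applicable
    with factor \<open>1\<close>.\<close>
  have P: "P k = (- 1, int p, k, k + 1)" "P (k + 1) = (int 1, - 1, k + 1, e)"
    using assms by (simp_all add: inc_code_def)
  have "reaches P (k, x, y) (k + 1, 0, y + p * x)" for y
  proof (induction x arbitrary: y)
    case 0
    then show ?case using P by (intro reaches_step) auto
  next
    case (Suc x)
    have "mstep P (k, Suc x, y) = (k, x, y + p)" using P by (simp add: nat_int_add)
    from reaches_Cons[OF this Suc[of "y + p"]] show ?case by (simp add: algebra_simps)
  qed
  from reaches_trans[OF this[where y = 0] reaches_move_left[of P "k + 1" 1 e, OF P(2)]]
  show ?thesis by simp
qed

text \<open>The decrement at \<open>k + 1\<close> tests the remainder; if it succeeds,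
  \<open>k + 3\<close> undoes it and the loop at \<open>k + 4\<close> rebuilds \<open>x\<close> as
  \<open>x mod p + p * (x div p)\<close>.\<close>

lemma reaches_dec_code:
  assumes "code_at P k (dec_code p k yes no)" "p > 0"
  shows "reaches P (k, x, 0) (if p dvd x then (yes, x div p, 0) else (no, x, 0))"
proof -
  have P: "P k = (- int p, 1, k, k + 1)" "P (k + 1) = (- 1, 0, k + 3, k + 2)"
    "P (k + 2) = (int 1, - 1, k + 2, yes)" "P (k + 3) = (1, 0, k + 4, k + 4)"
    "P (k + 4) = (int p, - 1, k + 4, no)"
    using assms by (simp_all add: dec_code_def eval_nat_numeral)
  have div: "reaches P (k, x, y) (k + 1, x mod p, y + x div p)" for x y
  proof (induction x arbitrary: y rule: less_induct)
    case (less x)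
    show ?case
    proof (cases "x < p")
      case True
      then show ?thesis using P by (intro reaches_step) auto
    next
      case False
      then have "mstep P (k, x, y) = (k, x - p, Suc y)" using P by (simp add: nat_diff_distrib nat_add_distrib)
      from reaches_Cons[OF this less[of "x - p" "Suc y"]] False assms(2) show ?thesis
        by (simp add: le_mod_geq le_div_geq)
    qed
  qed
  show ?thesis
  proof (cases "p dvd x")
    case True
    have "mstep P (k + 1, 0, x div p) = (k + 2, 0, x div p)" using P by simp
    with reaches_trans[OF reaches_step[OF this] reaches_move_left[of P "k + 2" 1 yes, OF P(3)]]
      div[of x 0] True
    show ?thesis by (auto intro: reaches_trans)
  next
    case False
    then have "x mod p > 0" by (simp add: mod_greater_zero_iff_not_dvd)
    then have "mstep P (k + 1, x mod p, x div p) = (k + 3, x mod p - 1, x div p)"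
      using P by simp
    moreover have "mstep P (k + 3, x mod p - 1, x div p) = (k + 4, x mod p, x div p)"
      using P \<open>x mod p > 0\<close> by (simp add: nat_add_distrib of_nat_diff)
    moreover have "reaches P (k + 4, x mod p, x div p) (no, x, 0)"
      using reaches_move_left[of P "k + 4" p no, OF P(5), of "x mod p" "x div p"] by simp
    ultimately have "reaches P (k + 1, x mod p, x div p) (no, x, 0)"
      by (blast intro: reaches_Cons)
    with div[of x 0] False show ?thesis by (auto intro: reaches_trans)
  qed
qed

section \<open>Simulation of register programs by two-counter machines\<close>

definition nth_prime :: "nat \<Rightarrow> nat" where
  "nth_prime = enumerate {p. prime p}"

lemma prime_nth_prime: "prime (nth_prime r)"
  using enumerate_in_set[of "{p::nat. prime p}" r] primes_infinite by (simp add: nth_prime_def)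

lemma nth_prime_eq_iff: "nth_prime r = nth_prime r' \<longleftrightarrow> r = r'"
  unfolding nth_prime_def using primes_infinite
  by (metis enumerate_mono less_irrefl linorder_neqE_nat)

text \<open>The register contents \<open>s\<close> are represented by the product of the powers
  \<open>nth_prime r ^ s r\<close>.\<close>

definition represents :: "nat \<Rightarrow> (nat \<Rightarrow> nat) \<Rightarrow> bool" where
  "represents n s \<longleftrightarrow> n > 0 \<and> (\<forall>r. multiplicity (nth_prime r) n = s r)"

lemma multiplicity_nth_prime_mult:
  assumes "n > 0"
  shows "multiplicity (nth_prime r') (nth_prime r * n) =
    (if r' = r then Suc (multiplicity (nth_prime r') n) else multiplicity (nth_prime r') n)"
proof -
  have "multiplicity (nth_prime r') (nth_prime r * n) =
      multiplicity (nth_prime r') (nth_prime r) + multiplicity (nth_prime r') n"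
    using assms prime_nth_prime[of r'] prime_gt_0_nat[OF prime_nth_prime[of r]]
    by (intro prime_elem_multiplicity_mult_distrib) simp_all
  moreover have "multiplicity (nth_prime r') (nth_prime r) = (if r' = r then 1 else 0)"
    using prime_nth_prime by (simp add: nth_prime_eq_iff prime_multiplicity_other)
  ultimately show ?thesis by simp
qed

lemma represents_mult:
  "represents n s \<Longrightarrow> represents (nth_prime r * n) (s(r := Suc (s r)))"
  unfolding represents_def
  by (auto simp: multiplicity_nth_prime_mult prime_gt_0_nat prime_nth_prime)

lemma represents_mult_power:
  "represents n s \<Longrightarrow> represents (nth_prime r ^ m * n) (s(r := m + s r))"
proof (induction m)
  case (Suc m)
  from represents_mult[OF Suc.IH[OF Suc.prems], of r] show ?case by (simp add: mult.assoc fun_upd_def cong: if_cong)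
qed simp

lemma represents_one: "represents 1 (\<lambda>r. 0)"
  by (simp add: represents_def)

lemma represents_dvd: "represents n s \<Longrightarrow> nth_prime r dvd n \<longleftrightarrow> s r > 0"
  unfolding represents_def
  using prime_multiplicity_gt_zero_iff[of "nth_prime r" n] prime_nth_prime[of r] by auto

lemma represents_div:
  assumes "represents n s" "s r = Suc m"
  shows "represents (n div nth_prime r) (s(r := m))"
proof -
  from assms obtain n' where n: "n = nth_prime r * n'"
    using represents_dvd[of n s r] by (auto elim: dvdE)
  then have "n' > 0" "n div nth_prime r = n'"
    using assms(1) prime_gt_0_nat[OF prime_nth_prime[of r]] by (auto simp: represents_def)
  moreover from this have "(if r' = r then Suc (multiplicity (nth_prime r') n')
      else multiplicity (nth_prime r') n') = s r'" for r'
    using assms(1) multiplicity_nth_prime_mult[of n' r' r] by (simp add: represents_def n)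
  then have "multiplicity (nth_prime r') n' = (s(r := m)) r'" for r'
    using assms(2) by (metis fun_upd_apply nat.inject)
  ultimately show ?thesis
    by (simp add: represents_def)
qed

primrec com_length :: "com \<Rightarrow> nat" where
  "com_length Skip = 1"
| "com_length (Inc r) = 2"
| "com_length (Seq c c') = com_length c + com_length c'"
| "com_length (Loop r c) = 5 + com_length c"

text \<open>A block placed at address \<open>k\<close> is left only by jumping to \<open>e\<close>.
  The unconditional jump \<open>(0, 0, e, e)\<close> keeps even the code of \<open>Skip\<close>
  nonempty, so the start address of a block always lies in the block.\<close>

primrec com_code :: "com \<Rightarrow> nat \<Rightarrow> nat \<Rightarrow> instr list" where
  "com_code Skip = (\<lambda>k e. [(0, 0, e, e)])"
| "com_code (Inc r) = (\<lambda>k e. inc_code (nth_prime r) k e)"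
| "com_code (Seq c c') = (\<lambda>k e. com_code c k (k + com_length c) @ com_code c' (k + com_length c) e)"
| "com_code (Loop r c) = (\<lambda>k e. dec_code (nth_prime r) k (k + 5) e @ com_code c (k + 5) k)"

lemma length_com_code [simp]: "length (com_code c k e) = com_length c"
  by (induction c arbitrary: k e) (auto simp: inc_code_def dec_code_def)

lemma com_length_pos: "com_length c > 0"
  by (induction c) auto

text \<open>Needed because jump targets become control states of the VASS-MDP, so the addresses of
  the program must be closed under jumps.\<close>

lemma com_code_targets:
  "(a, b, l, l') \<in> set (com_code c k e) \<Longrightarrow>
     l \<in> insert e {k..<k + com_length c} \<and> l' \<in> insert e {k..<k + com_length c}"
proof (induction c arbitrary: k e)
  case (Seq c c')
  then have "(a, b, l, l') \<in> set (com_code c k (k + com_length c)) \<or>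
      (a, b, l, l') \<in> set (com_code c' (k + com_length c) e)" by simp
  with Seq.IH[of k "k + com_length c"] Seq.IH(2)[of "k + com_length c" e] com_length_pos[of c']
  show ?case by auto
next
  case (Loop r c)
  then consider "(a, b, l, l') \<in> set (dec_code (nth_prime r) k (k + 5) e)"
    | "(a, b, l, l') \<in> set (com_code c (k + 5) k)" by auto
  then show ?case
  proof cases
    case 1
    then show ?thesis using com_length_pos[of c] by (auto simp: dec_code_def)
  next
    case 2
    then show ?thesis using Loop.IH[of "k + 5" k] by auto
  qed
qed (auto simp: inc_code_def)

text \<open>By induction on the execution: the body of a loop jumps back to \<open>k\<close>, so the
  same block serves the remaining rounds. Between commands the second counter is
  \<open>0\<close>.\<close>

lemma com_code_correct:
  assumes "exec c s s'" "code_at P k (com_code c k e)" "represents n s"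
  shows "\<exists>n'. represents n' s' \<and> reaches P (k, n, 0) (e, n', 0)"
  using assms
proof (induction c s s' arbitrary: k e n)
  case (exec_Skip s)
  then have "mstep P (k, n, 0) = (e, n, 0)" by simp
  with exec_Skip show ?case using reaches_step by blast
next
  case (exec_Inc r s)
  then have "code_at P k (inc_code (nth_prime r) k e)" by simp
  with exec_Inc show ?case using represents_mult reaches_inc_code by blast
next
  case (exec_Seq c s s' c' s'')
  from exec_Seq.prems have code: "code_at P k (com_code c k (k + com_length c))"
    "code_at P (k + com_length c) (com_code c' (k + com_length c) e)" by simp_all
  from exec_Seq.IH(1)[OF code(1) exec_Seq.prems(2)] exec_Seq.IH(2)[OF code(2)] show ?case
    using reaches_trans by blast
next
  case (exec_Loop_0 s r c)
  then have "code_at P k (dec_code (nth_prime r) k (k + 5) e)" by simp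
  from reaches_dec_code[OF this, of n] exec_Loop_0 show ?case
    using represents_dvd[of n s r] prime_gt_0_nat[OF prime_nth_prime[of r]] by auto
next
  case (exec_Loop_Suc s r m c s' s'')
  from exec_Loop_Suc.prems have code: "code_at P k (dec_code (nth_prime r) k (k + 5) e)"
    "code_at P (k + 5) (com_code c (k + 5) k)" by simp_all
  have "reaches P (k, n, 0) (k + 5, n div nth_prime r, 0)"
    using reaches_dec_code[OF code(1), of n] represents_dvd[OF exec_Loop_Suc.prems(2), of r]
      exec_Loop_Suc.hyps(1) prime_gt_0_nat[OF prime_nth_prime[of r]] by auto
  moreover obtain n' where "represents n' s'" "reaches P (k + 5, n div nth_prime r, 0) (k, n', 0)"
    using exec_Loop_Suc.IH(1)[OF code(2)] represents_div[OF exec_Loop_Suc.prems(2)]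
      exec_Loop_Suc.hyps(1) by blast
  moreover obtain n'' where "represents n'' s''" "reaches P (k, n', 0) (e, n'', 0)"
    using exec_Loop_Suc.IH(2)[OF exec_Loop_Suc.prems(1)] calculation(2) by blast
  ultimately show ?case using reaches_trans by blast
qed

text \<open>The label \<open>0\<close> is the halting label: the machine halts if \<open>h\<close> yields \<open>0\<close> on the first
  three registers, and ends in the idle loop at \<open>e + 5\<close> otherwise.\<close>

definition decide_com :: "recf \<Rightarrow> com" where
  "decide_com h = compile h [0, 1, 2] 3 4"

text \<open>Addresses start at \<open>1\<close> because \<open>0\<close> is the halting label.
  Register \<open>3\<close> holds the answer, and its prime divides the first counter iff the answer
  is positive, so the final \<open>dec_code\<close> branches on it.\<close>

definition decide_code :: "recf \<Rightarrow> instr list" where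
  "decide_code h = (let e = Suc (com_length (decide_com h)) in
     (0, 0, 0, 0) # com_code (decide_com h) 1 e @
     dec_code (nth_prime 3) e (e + 5) 0 @ [(0, 0, e + 5, e + 5)])"

lemma decide_code_targets:
  assumes "(a, b, l, l') \<in> set (decide_code h)"
  shows "l < length (decide_code h)" "l' < length (decide_code h)"
  using assms com_code_targets[of a b l l' "decide_com h"]
  by (fastforce simp: decide_code_def Let_def dec_code_def)+

text \<open>Goedel number of the registers \<open>a, b, c, 0, 0, ...\<close>. It enters through the
  initial counter and not through the program.\<close>

definition input_counter :: "nat \<Rightarrow> nat \<Rightarrow> nat \<Rightarrow> nat" where
  "input_counter a b c = nth_prime 0 ^ a * (nth_prime 1 ^ b * nth_prime 2 ^ c)"

lemma decide_code_correct:
  assumes "computes h [a, b, c] y"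
  defines "P \<equiv> \<lambda>l. decide_code h ! l"
  shows "y = 0 \<longleftrightarrow> (\<exists>m. fst ((mstep P ^^ m) (1, input_counter a b c, 0)) = 0)"
proof -
  let ?c0 = "(1, input_counter a b c, 0)" and ?e = "Suc (com_length (decide_com h))"
  have "code_at P 0 (decide_code h)" by (simp add: code_at_def P_def)
  then have code: "P 0 = (0, 0, 0, 0)" "code_at P 1 (com_code (decide_com h) 1 ?e)"
    "code_at P ?e (dec_code (nth_prime 3) ?e (?e + 5) 0)" "P (?e + 5) = (0, 0, ?e + 5, ?e + 5)"
    by (simp_all add: decide_code_def Let_def dec_code_def eval_nat_numeral)
  let ?s0 = "(\<lambda>r. 0::nat)(2 := c, 1 := b, 0 := a)"
  have "represents (input_counter a b c) ?s0"
    using represents_mult_power[OF represents_mult_power[OF represents_mult_power[OF represents_one]],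
        where r = 0 and m = a and r1 = 1 and m1 = b and r2 = 2 and m2 = c]
    by (simp add: input_counter_def)
  moreover obtain s' where s': "exec (decide_com h) ?s0 s'" "s' 3 = y"
    by (rule implementsD[OF compile_correct[OF assms(1)], of ?s0 "[0, 1, 2]" 4 3])
      (auto simp: decide_com_def)
  ultimately obtain n where n: "represents n s'" "reaches P ?c0 (?e, n, 0)"
    using com_code_correct code(2) by blast
  have final: "reaches P ?c0 (if y = 0 then (0, n, 0) else (?e + 5, n div nth_prime 3, 0))"
    using reaches_trans[OF n(2) reaches_dec_code[OF code(3)]] represents_dvd[OF n(1), of 3] s'(2)
      prime_gt_0_nat[OF prime_nth_prime[of 3]] by auto
  show ?thesis
  proof
    assume "y = 0"
    with final show "\<exists>m. fst ((mstep P ^^ m) ?c0) = 0"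
      unfolding reaches_def by (metis fst_conv)
  next
    assume "\<exists>m. fst ((mstep P ^^ m) ?c0) = 0"
    then obtain x y' where "reaches P ?c0 (0, x, y')"
      unfolding reaches_def by (metis prod.collapse)
    \<comment> \<open>Label \<open>0\<close> and the idle loop are both fixed points, so a run that
      ends in the idle loop cannot have visited label \<open>0\<close>.\<close>
    moreover have "mstep P (0, x, y') = (0, x, y')" "mstep P (?e + 5, z, 0) = (?e + 5, z, 0)" for z
      using code(1,4) by simp_all
    ultimately show "y = 0"
      using final reaches_fixed_unique[of P ?c0 "(0, x, y')" "(?e + 5, n div nth_prime 3, 0)"]
      by (cases "y = 0") auto
  qed
qed

section \<open>Supermartingale bounds for reachability probabilities\<close>

text \<open>Law of the first \<open>n\<close> configurations. Being discrete, it lets expectations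
  be computed one step at a time by \<open>nn_integral_bind_pmf\<close>;
  \<open>emeasure_prefix\<close> identifies it as a marginal of \<open>play_measure\<close>.\<close>

primrec prefix_pmf :: "'c mdp \<Rightarrow> 'c \<Rightarrow> ('c list \<Rightarrow> 'c) \<Rightarrow> nat \<Rightarrow> 'c list pmf" where
  "prefix_pmf M c \<sigma> 0 = return_pmf []"
| "prefix_pmf M c \<sigma> (Suc n) =
     bind_pmf (prefix_pmf M c \<sigma> n) (\<lambda>w. map_pmf (\<lambda>x. w @ [x]) (next_conf M c \<sigma> w))"

lemma length_prefix_pmf: "w \<in> set_pmf (prefix_pmf M c \<sigma> n) \<Longrightarrow> length w = n"
  by (induction n arbitrary: w) auto

text \<open>This is the product of \<open>play_measure_cylinder\<close>, hence the link between the
  two descriptions.\<close>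

lemma pmf_prefix_pmf:
  "length w = n \<Longrightarrow>
     pmf (prefix_pmf M c \<sigma> n) w = (\<Prod>i<n. pmf (next_conf M c \<sigma> (take i w)) (w ! i))"
proof (induction n arbitrary: w)
  case 0
  then show ?case by simp
next
  case (Suc n)
  then obtain v x where w: "w = v @ [x]" "length v = n" by (metis length_Suc_conv_rev)
  have snoc: "pmf (map_pmf (\<lambda>y. u @ [y]) N) (v @ [x]) = (if u = v then pmf N x else 0)" for u N
  proof (cases "u = v")
    case True
    then show ?thesis by (auto intro!: pmf_map_inj' injI)
  next
    case False
    then have "v @ [x] \<notin> set_pmf (map_pmf (\<lambda>y. u @ [y]) N)" by auto
    then have "pmf (map_pmf (\<lambda>y. u @ [y]) N) (v @ [x]) = 0" by (simp only: set_pmf_iff not_not)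
    with False show ?thesis by simp
  qed
  have "pmf (prefix_pmf M c \<sigma> (Suc n)) w =
      (\<integral>u. (if u = v then pmf (next_conf M c \<sigma> u) x else 0) \<partial>prefix_pmf M c \<sigma> n)"
    by (simp add: pmf_bind w snoc)
  also have "\<dots> = (\<Sum>u\<in>{v}. (if u = v then pmf (next_conf M c \<sigma> u) x else 0) * pmf (prefix_pmf M c \<sigma> n) u)"
    by (rule integral_measure_pmf_real) (auto split: if_splits)
  also have "\<dots> = pmf (next_conf M c \<sigma> v) x * pmf (prefix_pmf M c \<sigma> n) v" by simp
  also have "\<dots> = (\<Prod>i<Suc n. pmf (next_conf M c \<sigma> (take i w)) (w ! i))"
    using Suc.IH[OF w(2)] w(2) by (simp add: w(1) nth_append mult.commute)
  finally show ?case .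
qed

lemma map_upt_eq_iff: "map f [0..<n] = w \<longleftrightarrow> length w = n \<and> (\<forall>i<n. f i = w ! i)"
  unfolding list_eq_iff_nth_eq by auto

lemma take_map_nth: "i \<le> length w \<Longrightarrow> map ((!) w) [0..<i] = take i w"
  unfolding map_upt_eq_iff by simp

lemma measurable_prefix:
  fixes M :: "'c::countable mdp"
  shows "(\<lambda>\<omega>. map \<omega> [0..<n]) \<in> measurable (play_measure M c \<sigma>) (count_space UNIV)"
proof -
  let ?N = "PiM UNIV (\<lambda>_::nat. count_space (UNIV :: 'c set))"
  have "(\<lambda>\<omega>. map \<omega> [0..<n]) \<in> measurable ?N (count_space UNIV)"
  proof (subst measurable_count_space_eq2_countable, intro conjI ballI)
    fix w :: "'c list"
    have "(\<lambda>\<omega>. map \<omega> [0..<n]) -` {w} \<inter> space ?N =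
        (if length w = n then {\<omega> \<in> space ?N. \<forall>i<n. \<omega> i = w ! i} else {})"
      by (auto simp: map_upt_eq_iff)
    moreover have "Measurable.pred ?N (\<lambda>\<omega>. i < n \<longrightarrow> \<omega> i = w ! i)" for i
      by (rule measurable_compose[OF measurable_component_singleton, of i]) simp_all
    then have "Measurable.pred ?N (\<lambda>\<omega>. \<forall>i<n. \<omega> i = w ! i)"
      by (rule pred_intros_countable(1))
    then have "{\<omega> \<in> space ?N. \<forall>i<n. \<omega> i = w ! i} \<in> sets ?N"
      by (simp only: pred_def)
    ultimately show "(\<lambda>\<omega>. map \<omega> [0..<n]) -` {w} \<inter> space ?N \<in> sets ?N" by simp
  qed simp_all
  then show ?thesis by (simp add: measurable_cong_sets[OF sets_play_measure refl])
qed

lemma space_play_measure: "space (play_measure M c \<sigma>) = UNIV"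
  using sets_eq_imp_space_eq[OF sets_play_measure[of M c \<sigma>]] by (simp add: space_PiM)

lemma sets_prefix:
  fixes M :: "'c::countable mdp"
  shows "{\<omega>. map \<omega> [0..<n] \<in> X} \<in> sets (play_measure M c \<sigma>)"
  using measurable_sets[OF measurable_prefix, of X n M c \<sigma>]
  by (simp add: space_play_measure vimage_def)

lemma emeasure_prefix_single:
  fixes M :: "'c::countable mdp"
  shows "emeasure (play_measure M c \<sigma>) {\<omega>. map \<omega> [0..<n] = w} = pmf (prefix_pmf M c \<sigma> n) w"
proof (cases "length w = n")
  case True
  interpret prob_space "play_measure M c \<sigma>" by (rule prob_space_play_measure)
  have "{\<omega>. map \<omega> [0..<n] = w} = {\<omega>. \<forall>i<n. \<omega> i = w ! i}"
    using True by (auto simp: map_upt_eq_iff)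
  then have "measure (play_measure M c \<sigma>) {\<omega>. map \<omega> [0..<n] = w} =
      (\<Prod>i<n. pmf (next_conf M c \<sigma> (map ((!) w) [0..<i])) (w ! i))"
    by (simp only: play_measure_cylinder)
  also have "\<dots> = (\<Prod>i<n. pmf (next_conf M c \<sigma> (take i w)) (w ! i))"
  proof (rule prod.cong[OF refl])
    fix i assume "i \<in> {..<n}"
    with True have "map ((!) w) [0..<i] = take i w" by (intro take_map_nth) simp
    then show "pmf (next_conf M c \<sigma> (map ((!) w) [0..<i])) (w ! i) =
        pmf (next_conf M c \<sigma> (take i w)) (w ! i)" by (simp only:)
  qed
  also have "\<dots> = pmf (prefix_pmf M c \<sigma> n) w"
    by (rule pmf_prefix_pmf[OF True, symmetric])
  finally show ?thesis
    by (simp only: emeasure_eq_measure)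
next
  case False
  then have "emeasure (play_measure M c \<sigma>) {\<omega>. map \<omega> [0..<n] = w} = emeasure (play_measure M c \<sigma>) {}"
    by (intro arg_cong[of _ _ "emeasure (play_measure M c \<sigma>)"]) auto
  also have "\<dots> = pmf (prefix_pmf M c \<sigma> n) w"
    using length_prefix_pmf[of w M c \<sigma> n] False pmf_eq_0_set_pmf[of "prefix_pmf M c \<sigma> n" w]
    by auto
  finally show ?thesis .
qed

lemma emeasure_prefix:
  fixes M :: "'c::countable mdp"
  shows "emeasure (play_measure M c \<sigma>) {\<omega>. map \<omega> [0..<n] \<in> X} = emeasure (prefix_pmf M c \<sigma> n) X"
proof -
  let ?D = "distr (play_measure M c \<sigma>) (count_space UNIV) (\<lambda>\<omega>. map \<omega> [0..<n])"
  have D: "emeasure ?D X = emeasure (play_measure M c \<sigma>) {\<omega>. map \<omega> [0..<n] \<in> X}" for X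
    by (subst emeasure_distr[OF measurable_prefix]) (simp_all add: space_play_measure vimage_def)
  have "?D = measure_pmf (prefix_pmf M c \<sigma> n)"
  proof (rule measure_eqI_countable[where A = UNIV])
    fix w :: "'c list"
    show "emeasure ?D {w} = emeasure (prefix_pmf M c \<sigma> n) {w}"
      unfolding D emeasure_pmf_single singleton_iff by (rule emeasure_prefix_single)
  qed simp_all
  with D show ?thesis by simp
qed

text \<open>The supermartingale condition, with geometric decay if \<open>a < 1\<close>.
  \<open>V\<close> lives on histories because strategies do; the empty history is left out since its
  only extension is the initial configuration.\<close>

definition superharmonic ::
    "'c mdp \<Rightarrow> 'c \<Rightarrow> ('c list \<Rightarrow> 'c) \<Rightarrow> ennreal \<Rightarrow> ('c list \<Rightarrow> ennreal) \<Rightarrow> bool" where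
  "superharmonic M c \<sigma> a V \<longleftrightarrow>
     (\<forall>w. w \<noteq> [] \<longrightarrow> (\<integral>\<^sup>+x. V (w @ [x]) \<partial>next_conf M c \<sigma> w) \<le> a * V w)"

text \<open>A history of \<open>Suc n\<close> configurations contains only \<open>n\<close> steps,
  which explains the exponent.\<close>

lemma nn_integral_prefix_le:
  assumes "superharmonic M c \<sigma> a V"
  shows "(\<integral>\<^sup>+w. V w \<partial>prefix_pmf M c \<sigma> (Suc n)) \<le> a ^ n * V [c]"
proof (induction n)
  case 0
  show ?case by (simp add: bind_return_pmf next_conf_def)
next
  case (Suc n)
  let ?P = "prefix_pmf M c \<sigma> (Suc n)"
  have "(\<integral>\<^sup>+w. V w \<partial>prefix_pmf M c \<sigma> (Suc (Suc n))) =
      (\<integral>\<^sup>+w. (\<integral>\<^sup>+x. V (w @ [x]) \<partial>next_conf M c \<sigma> w) \<partial>?P)"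
    by (subst prefix_pmf.simps(2)) (simp add: nn_integral_bind_pmf nn_integral_map_pmf
        del: prefix_pmf.simps)
  also have "\<dots> \<le> (\<integral>\<^sup>+w. a * V w \<partial>?P)"
  proof (intro nn_integral_mono_AE AE_pmfI)
    fix w assume "w \<in> set_pmf ?P"
    then have "w \<noteq> []" using length_prefix_pmf by fastforce
    with assms show "(\<integral>\<^sup>+x. V (w @ [x]) \<partial>next_conf M c \<sigma> w) \<le> a * V w"
      unfolding superharmonic_def by blast
  qed
  also have "\<dots> = a * (\<integral>\<^sup>+w. V w \<partial>?P)"
    by (rule nn_integral_cmult) simp
  also have "\<dots> \<le> a * (a ^ n * V [c])"
    by (intro mult_left_mono Suc) simp
  finally show ?case by (simp add: mult.assoc)
qed

text \<open>Markov's inequality at one suitable time \<open>n\<close> bounds each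
  \<open>?C k\<close>, and these sets increase with \<open>k\<close>. The form "eventually in
  \<open>X\<close>" serves both bounds below: a goal that stays visited, and a goal that is missed
  from some time on.\<close>

lemma emeasure_eventually_le:
  fixes M :: "'c::countable mdp"
  assumes "superharmonic M c \<sigma> a V" "\<And>w. w \<in> X \<Longrightarrow> V w \<ge> 1" "\<And>k. \<exists>n\<ge>k. a ^ n * V [c] \<le> b"
  shows "emeasure (play_measure M c \<sigma>) {\<omega>. \<exists>k. \<forall>n\<ge>k. map \<omega> [0..<Suc n] \<in> X} \<le> b"
    and "{\<omega>. \<exists>k. \<forall>n\<ge>k. map \<omega> [0..<Suc n] \<in> X} \<in> sets (play_measure M c \<sigma>)"
proof -
  let ?P = "play_measure M c \<sigma>" and ?B = "\<lambda>n. {\<omega>. map \<omega> [0..<Suc n] \<in> X}"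
  let ?C = "\<lambda>k. \<Inter>n\<in>{k..}. ?B n"
  have B: "?B n \<in> sets ?P" for n by (rule sets_prefix)
  have "UNIV \<in> sets ?P" by (metis sets.top space_play_measure)
  then have C: "?C k \<in> sets ?P" for k using B by (intro sets.countable_INT'') auto
  have eq: "{\<omega>. \<exists>k. \<forall>n\<ge>k. map \<omega> [0..<Suc n] \<in> X} = (\<Union>k. ?C k)" by auto
  have "emeasure ?P (?C k) \<le> b" for k
  proof -
    obtain n where n: "n \<ge> k" "a ^ n * V [c] \<le> b" using assms(3) by blast
    have "emeasure ?P (?C k) \<le> emeasure ?P (?B n)"
      using n(1) by (intro emeasure_mono B) auto
    also have "\<dots> = (\<integral>\<^sup>+w. indicator X w \<partial>prefix_pmf M c \<sigma> (Suc n))"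
      by (simp add: emeasure_prefix del: prefix_pmf.simps upt_Suc)
    also have "\<dots> \<le> (\<integral>\<^sup>+w. V w \<partial>prefix_pmf M c \<sigma> (Suc n))"
      using assms(2) by (intro nn_integral_mono) (auto simp: indicator_def)
    also have "\<dots> \<le> b" using nn_integral_prefix_le[OF assms(1)] n(2) by (rule order_trans)
    finally show ?thesis .
  qed
  then have "(SUP k. emeasure ?P (?C k)) \<le> b" by (rule SUP_least)
  also have "(SUP k. emeasure ?P (?C k)) = emeasure ?P (\<Union>k. ?C k)"
  proof (rule SUP_emeasure_incseq)
    show "range ?C \<subseteq> sets ?P" using C by blast
    show "incseq ?C" by (intro monoI INF_superset_mono) auto
  qed
  finally show "emeasure ?P {\<omega>. \<exists>k. \<forall>n\<ge>k. map \<omega> [0..<Suc n] \<in> X} \<le> b"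
    by (simp only: eq)
  show "{\<omega>. \<exists>k. \<forall>n\<ge>k. map \<omega> [0..<Suc n] \<in> X} \<in> sets ?P"
    unfolding eq by (rule sets.countable_UN) (use C in blast)
qed

section \<open>From supermartingales to the probability of reaching a set\<close>

lemma finite_play_snoc:
  "w \<noteq> [] \<Longrightarrow> finite_play M (w @ [x]) \<longleftrightarrow> finite_play M w \<and> x \<in> confs M \<and> step M (last w) x"
  unfolding finite_play_def by (auto simp: successively_append_iff)

lemma finite_play_prefix:
  assumes "\<omega> \<in> plays M"
  shows "finite_play M (map \<omega> [0..<Suc n])"
proof (induction n)
  case 0
  show ?case using assms by (simp add: finite_play_def plays_def)
next
  case (Suc n)
  have "map \<omega> [0..<Suc (Suc n)] = map \<omega> [0..<Suc n] @ [\<omega> (Suc n)]" by simp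
  moreover have "last (map \<omega> [0..<Suc n]) = \<omega> n" by simp
  ultimately show ?case using Suc finite_play_snoc[of "map \<omega> [0..<Suc n]" M] assms
    by (simp add: plays_def del: upt_Suc)
qed

lemma playsI:
  assumes "\<And>k. \<exists>n\<ge>k. finite_play M (map \<omega> [0..<Suc n])"
  shows "\<omega> \<in> plays M"
proof -
  have "\<omega> i \<in> confs M \<and> step M (\<omega> i) (\<omega> (Suc i))" for i
  proof -
    obtain n where n: "n \<ge> Suc i" "finite_play M (map \<omega> [0..<Suc n])" using assms by blast
    then have "successively (step M) (map \<omega> [0..<Suc n])" "\<omega> i \<in> confs M"
      by (auto simp: finite_play_def)
    with n(1) show ?thesis
      by (simp add: successively_conv_nth del: upt_Suc)
  qed
  then show ?thesis by (simp add: plays_def)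
qed

text \<open>Having visited \<open>G\<close> is preserved when a play is prolonged, so reaching
  \<open>G\<close> means that the prefixes are eventually in \<open>?X\<close>.\<close>

lemma measure_reach_le:
  fixes M :: "'c::countable mdp"
  assumes "superharmonic M c \<sigma> 1 V" "V [c] \<le> ennreal b" "0 \<le> b"
    "\<And>w x. finite_play M w \<Longrightarrow> x \<in> set w \<Longrightarrow> G x \<Longrightarrow> V w \<ge> 1"
  shows "measure (play_measure M c \<sigma>) {\<omega> \<in> plays M. \<exists>i. G (\<omega> i)} \<le> b"
proof -
  let ?X = "{w. finite_play M w \<and> (\<exists>x\<in>set w. G x)}"
  let ?E = "{\<omega>. \<exists>k. \<forall>n\<ge>k. map \<omega> [0..<Suc n] \<in> ?X}"
  have E: "emeasure (play_measure M c \<sigma>) ?E \<le> b" "?E \<in> sets (play_measure M c \<sigma>)"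
    by (rule emeasure_eventually_le[OF assms(1)]; use assms(2,4) in auto)+
  have "{\<omega> \<in> plays M. \<exists>i. G (\<omega> i)} \<subseteq> ?E"
  proof safe
    fix \<omega> i
    assume "\<omega> \<in> plays M" "G (\<omega> i)"
    then show "\<exists>k. \<forall>n\<ge>k. map \<omega> [0..<Suc n] \<in> ?X"
      by (intro exI[of _ i]) (auto simp: finite_play_prefix simp del: upt_Suc)
  qed
  from emeasure_mono[OF this E(2)] E(1)
  have "emeasure (play_measure M c \<sigma>) {\<omega> \<in> plays M. \<exists>i. G (\<omega> i)} \<le> b" by (rule order_trans)
  with assms(3) show ?thesis by (simp add: measure_def enn2real_leI)
qed

text \<open>The bound \<open>a ^ n * V [c]\<close> tends to \<open>0\<close>, so almost surely
  infinitely many prefixes are finite plays ending in \<open>G\<close>. This also shows, by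
  \<open>playsI\<close>, that the sequence is almost surely a play.\<close>

lemma measure_reach_eq_1:
  fixes M :: "'c::countable mdp"
  assumes "superharmonic M c \<sigma> (ennreal a) V" "V [c] < \<infinity>" "0 \<le> a" "a < 1"
    "\<And>w. V w < 1 \<Longrightarrow> finite_play M w \<and> G (last w)"
    "{\<omega> \<in> plays M. \<exists>i. G (\<omega> i)} \<in> sets (play_measure M c \<sigma>)"
  shows "measure (play_measure M c \<sigma>) {\<omega> \<in> plays M. \<exists>i. G (\<omega> i)} = 1"
proof -
  interpret prob_space "play_measure M c \<sigma>" by (rule prob_space_play_measure)
  let ?X = "{w. \<not> (finite_play M w \<and> G (last w))}"
  let ?E = "{\<omega>. \<exists>k. \<forall>n\<ge>k. map \<omega> [0..<Suc n] \<in> ?X}"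
  obtain v where v: "V [c] = ennreal v" "v \<ge> 0" using assms(2) by (cases "V [c]") auto
  have lim: "(\<lambda>n. a ^ n * v) \<longlonglongrightarrow> 0"
    using LIMSEQ_realpow_zero[OF assms(3,4)] by (rule tendsto_mult_left_zero)
  have small: "\<exists>n\<ge>k. ennreal a ^ n * V [c] \<le> ennreal e" if e: "e > 0" for k e
  proof -
    from order_tendstoD(2)[OF lim e] obtain n where "n \<ge> k" "a ^ n * v < e"
      unfolding eventually_sequentially by (metis nat_le_linear)
    then show ?thesis
      using v(2) assms(3) by (auto simp: v(1) ennreal_power simp flip: ennreal_mult intro!: ennreal_leI exI[of _ n])
  qed
  have V: "V w \<ge> 1" if "w \<in> ?X" for w using assms(5)[of w] that by (auto simp: not_less[symmetric])
  have E: "emeasure (play_measure M c \<sigma>) ?E \<le> ennreal e" if e: "e > 0" for e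
    by (rule emeasure_eventually_le(1)[OF assms(1)]) (use V small[OF e] in auto)
  have sets: "?E \<in> sets (play_measure M c \<sigma>)"
    by (rule emeasure_eventually_le(2)[OF assms(1) _ small[of 1]]) (use V in auto)
  have "emeasure (play_measure M c \<sigma>) ?E \<le> 0"
    by (rule ennreal_le_epsilon) (use E in auto)
  then have "emeasure (play_measure M c \<sigma>) ?E = 0" by simp
  then have "AE \<omega> in play_measure M c \<sigma>. \<omega> \<notin> ?E"
    using sets by (intro AE_not_in null_setsI)
  moreover have "\<omega> \<in> plays M \<and> (\<exists>i. G (\<omega> i))" if "\<omega> \<notin> ?E" for \<omega>
  proof -
    from that have *: "\<exists>n\<ge>k. finite_play M (map \<omega> [0..<Suc n]) \<and> G (last (map \<omega> [0..<Suc n]))" for k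
      by auto
    then have "\<omega> \<in> plays M" by (intro playsI) blast
    with *[of 0] show ?thesis by (auto simp: last_map)
  qed
  ultimately have "AE \<omega> in play_measure M c \<sigma>. \<omega> \<in> {\<omega> \<in> plays M. \<exists>i. G (\<omega> i)}"
    by (auto elim: eventually_mono)
  with assms(6) show ?thesis by (simp add: prob_eq_1)
qed

section \<open>Expectations in VASS-MDPs\<close>

lemma embed_pmf_move_prob:
  assumes "vass_mdp d S" "\<And>t. t \<in> trans S \<Longrightarrow> weight S t = 1" "step (induced_mdp d S) c c'"
  shows "embed_pmf (move_prob (induced_mdp d S) c) = map_pmf (target c) (pmf_of_set (enabled S c))"
proof (rule pmf_eqI)
  fix x
  have sub: "enabled S c \<subseteq> trans S" by (auto simp: enabled_def)
  then have fin: "finite (enabled S c)" using assms(1) finite_subset by (auto simp: vass_mdp_def)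
  have ne: "enabled S c \<noteq> {}" using assms(3) by (auto simp: induced_mdp_def)
  have card: "(\<Sum>t\<in>A. weight S t) = card A" if "A \<subseteq> enabled S c" for A
    using that sub assms(2) by (subst sum.cong[OF refl, of _ _ "\<lambda>_. 1"]) auto
  have card': "(\<Sum>t\<in>enabled S c. weight S t) = card (enabled S c)"
    "(\<Sum>t\<in>{t \<in> enabled S c. target c t = x}. weight S t) = card {t \<in> enabled S c. target c t = x}"
    by (rule card; blast)+
  have "pmf (embed_pmf (move_prob (induced_mdp d S) c)) x =
      real (card {t \<in> enabled S c. target c t = x}) / real (card (enabled S c))"
    unfolding pmf_embed_prob[OF assms(1,3)] unfolding induced_mdp_def mdp.simps card' ..
  also have "{t \<in> enabled S c. target c t = x} = enabled S c \<inter> target c -` {x}" by auto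
  also have "real (card (enabled S c \<inter> target c -` {x})) / real (card (enabled S c)) =
      pmf (map_pmf (target c) (pmf_of_set (enabled S c))) x"
    by (simp add: pmf_map measure_pmf_of_set[OF ne fin])
  finally show "pmf (embed_pmf (move_prob (induced_mdp d S) c)) x =
      pmf (map_pmf (target c) (pmf_of_set (enabled S c))) x" .
qed

lemma step_confs:
  assumes "vass_mdp d S" "step (induced_mdp d S) c c'"
  shows "c' \<in> confs (induced_mdp d S)"
  using assms by (fastforce simp: induced_mdp_def enabled_def vass_mdp_def target_def vec_add_def)

text \<open>Reduces the condition on histories to inequalities at single configurations. A list that
  is not a play has no extension that is one, so its value \<open>z\<close> only needs
  \<open>z \<le> a * z\<close>; later \<open>z\<close> is infinity for the factor \<open>3/4\<close>
  and \<open>0\<close> for the factor \<open>1\<close>.\<close>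

lemma superharmonic_confs:
  fixes a z :: ennreal and U :: "'q::countable conf \<Rightarrow> ennreal"
  assumes S: "vass_mdp d S" "\<And>t. t \<in> trans S \<Longrightarrow> weight S t = 1" "deadlock_free d S"
    and "strategy (induced_mdp d S) \<sigma>" "z \<le> a * z"
    and UP: "\<And>c. c \<in> confsP (induced_mdp d S) \<Longrightarrow>
      (\<Sum>t\<in>enabled S c. U (target c t)) / of_nat (card (enabled S c)) \<le> a * U c"
    and U1: "\<And>w. finite_play (induced_mdp d S) w \<Longrightarrow> last w \<in> confs1 (induced_mdp d S) \<Longrightarrow>
      U (\<sigma> w) \<le> a * U (last w)"
  shows "superharmonic (induced_mdp d S) c0 \<sigma> a
    (\<lambda>w. if finite_play (induced_mdp d S) w then U (last w) else z)"
  unfolding superharmonic_def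
proof (intro allI impI)
  fix w :: "'q conf list" assume w: "w \<noteq> []"
  let ?M = "induced_mdp d S"
  let ?V = "\<lambda>w. if finite_play ?M w then U (last w) else z"
  show "(\<integral>\<^sup>+x. ?V (w @ [x]) \<partial>next_conf ?M c0 \<sigma> w) \<le> a * ?V w"
  proof (cases "finite_play ?M w")
    case False
    with w have "?V (w @ [x]) = z" for x by (simp add: finite_play_snoc)
    with False assms(5) show ?thesis by simp
  next
    case True
    let ?c = "last w"
    have c: "?c \<in> confs ?M" using True w by (auto simp: finite_play_def)
    then obtain c' where c': "step ?M ?c c'" using S(3) by (auto simp: deadlock_free_def)
    have V: "?V (w @ [x]) = U x" if "step ?M ?c x" for x
      using that True w step_confs[OF S(1) that] by (simp add: finite_play_snoc)
    show ?thesis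
    proof (cases "?c \<in> confsP ?M")
      case P: True
      have fin: "finite (enabled S ?c)"
        using S(1) by (auto intro: finite_subset[of _ "trans S"] simp: enabled_def vass_mdp_def)
      have ne: "enabled S ?c \<noteq> {}" using c' by (auto simp: induced_mdp_def)
      have "(\<integral>\<^sup>+x. ?V (w @ [x]) \<partial>next_conf ?M c0 \<sigma> w) =
          (\<Sum>t\<in>enabled S ?c. ?V (w @ [target ?c t])) / of_nat (card (enabled S ?c))"
        using w P by (simp add: next_conf_def embed_pmf_move_prob[OF S(1,2) c']
            nn_integral_map_pmf nn_integral_pmf_of_set[OF ne fin] del: last_snoc)
      also have "(\<Sum>t\<in>enabled S ?c. ?V (w @ [target ?c t])) = (\<Sum>t\<in>enabled S ?c. U (target ?c t))"
      proof (rule sum.cong[OF refl])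
        fix t assume "t \<in> enabled S ?c"
        then have "step ?M ?c (target ?c t)" using c by (auto simp: induced_mdp_def)
        then show "?V (w @ [target ?c t]) = U (target ?c t)" by (rule V)
      qed
      also have "\<dots> / of_nat (card (enabled S ?c)) \<le> a * U ?c" by (rule UP[OF P])
      finally show ?thesis using True by simp
    next
      case False
      then have 1: "?c \<in> confs1 ?M" using c S(1) by (auto simp: induced_mdp_def vass_mdp_def)
      then have "step ?M ?c (\<sigma> w)" using assms(4) True by (simp add: strategy_def)
      then have "(\<integral>\<^sup>+x. ?V (w @ [x]) \<partial>next_conf ?M c0 \<sigma> w) = U (\<sigma> w)"
        using w False V by (simp add: next_conf_def nn_integral_return)
      with U1[OF True 1] True show ?thesis by simp
    qed
  qed
qed

lemma ennreal_divide_one: "x / 1 = (x::ennreal)"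
  by (simp add: divide_ennreal_def)

lemma ennreal_divide_2: "0 \<le> r \<Longrightarrow> ennreal r / 2 = ennreal (r / 2)"
  using divide_ennreal[of r 2] by simp

lemma half_sum_le:
  fixes u v w :: ennreal
  assumes "u \<le> w" "v \<le> w"
  shows "(u + v) / 2 \<le> w"
proof (cases w)
  case (real r)
  have "(u + v) / 2 \<le> (w + w) / 2" by (intro divide_right_mono_ennreal add_mono assms)
  also have "\<dots> = w" using real by (simp add: ennreal_divide_2 flip: ennreal_plus)
  finally show ?thesis .
qed simp

lemma half_ge_1:
  fixes w :: ennreal
  assumes "4 \<le> w"
  shows "\<not> w / 2 < 1"
proof (cases w)
  case (real r)
  then have "4 \<le> r" using assms by (metis ennreal_le_iff ennreal_numeral)
  with real show ?thesis by (simp add: ennreal_divide_2 not_less)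
qed (simp add: ennreal_top_divide)

text \<open>Origin of \<open>3/4\<close>: \<open>w\<close> and \<open>u\<close> are the values
  before and after a machine step, and \<open>w / 2\<close> is the value after an honest claim.
  Waiting or moving with equal chance gives at most \<open>(w / 2 + w / 4) / 2\<close>, which is
  \<open>3/4\<close> of \<open>w / 2\<close>.\<close>

lemma ennreal_value_bounds:
  fixes w u :: ennreal
  assumes "4 * u \<le> w"
  shows "(w / 2 + u) / 2 \<le> ennreal (3 / 4) * (w / 2)" "u \<le> ennreal (3 / 4) * (w / 2)"
    "w / 2 \<le> ennreal (3 / 4) * w"
proof -
  have "(w / 2 + u) / 2 \<le> ennreal (3 / 4) * (w / 2) \<and> u \<le> ennreal (3 / 4) * (w / 2) \<and>
    w / 2 \<le> ennreal (3 / 4) * w"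
  proof (cases w)
    case top
    then show ?thesis by (simp add: ennreal_mult_top ennreal_top_divide)
  next
    case (real r)
    with assms have "u \<noteq> \<infinity>" by (auto simp: ennreal_mult_top top_unique)
    then obtain v where v: "u = ennreal v" "0 \<le> v" by (cases u) auto
    have "ennreal (4 * v) \<le> ennreal r" using assms v real by (simp add: ennreal_mult)
    then have "4 * v \<le> r" using real(1) by simp
    then show ?thesis using real(1) v(2) unfolding real(2) v(1)
      by (simp add: ennreal_divide_2 flip: ennreal_plus ennreal_mult)
  qed
  then show "(w / 2 + u) / 2 \<le> ennreal (3 / 4) * (w / 2)" "u \<le> ennreal (3 / 4) * (w / 2)"
    "w / 2 \<le> ennreal (3 / 4) * w" by blast+
qed

section \<open>The VASS-MDP of a two-counter machine\<close>

text \<open>In the state \<open>3 * l\<close> Player 1 claims that the instruction at \<open>l\<close> is enabled, moving to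
  \<open>3 * l + 1\<close>, or that it is disabled, moving to \<open>3 * l + 2\<close>. If the first claim is false, the play
  is stuck in a loop; if the second one is false, the play ends in the sink \<open>1\<close> with
  probability at least \<open>1/2\<close>.\<close>

definition gadget :: "instr list \<Rightarrow> nat \<Rightarrow> nat transition list" where
  "gadget is l = (case is ! l of (a, b, q, q') \<Rightarrow>
     [(3 * l, [0, 0], 3 * l + 1), (3 * l, [0, 0], 3 * l + 2),
      (3 * l + 1, [a, b], 3 * q), (3 * l + 1, [0, 0], 3 * l + 1),
      (3 * l + 2, [a, b], 1), (3 * l + 2, [0, 0], 3 * q')])"

text \<open>Label \<open>0\<close> has no claim states: state \<open>0\<close> just loops, which
  leaves the number \<open>1\<close> free for the sink. \<open>remdups\<close> makes the
  distinctness demanded of presentations immediate.\<close>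

definition machine_vass :: "instr list \<Rightarrow> presentation" where
  "machine_vass is =
     (map (\<lambda>l. 3 * l) [0..<length is],
      1 # concat (map (\<lambda>l. [3 * l + 1, 3 * l + 2]) [1..<length is]),
      map (\<lambda>t. (t, 1)) (remdups ((0, [0, 0], 0) # (1, [0, 0], 1) #
        concat (map (gadget is) [1..<length is]))))"

lemma map_of_map_const: "t \<in> set ts \<Longrightarrow> map_of (map (\<lambda>t. (t, n)) ts) t = Some n"
  by (induction ts) auto

lemma fst_image_map_remdups: "fst ` set (map (\<lambda>t. (t, n)) (remdups ts)) = set ts"
  by (simp add: image_image)

lemma weight_vass_of_const:
  assumes "t \<in> trans (vass_of (qs1, qsP, map (\<lambda>t. (t, n)) ts))"
  shows "weight (vass_of (qs1, qsP, map (\<lambda>t. (t, n)) ts)) t = n"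
proof -
  have "t \<in> set ts" using assms by (simp add: image_image)
  then show ?thesis by (simp add: map_of_map_const)
qed

lemma gadget_div: "(q, z, q') \<in> set (gadget is l) \<Longrightarrow> q div 3 = l"
  by (auto simp: gadget_def split: prod.splits)

definition emb :: "mconf \<Rightarrow> nat conf" where
  "emb c = (case c of (l, x, y) \<Rightarrow> (3 * l, [x, y]))"

locale machine =
  fixes "is" :: "instr list"
  assumes length_gt_1: "length is > 1"
    and targets: "(a, b, q, q') \<in> set is \<Longrightarrow> q < length is \<and> q' < length is"
begin

abbreviation S :: "nat vass" where "S \<equiv> vass_of (machine_vass is)"
abbreviation M :: "nat conf mdp" where "M \<equiv> induced_mdp 2 S"
abbreviation mstep' :: "mconf \<Rightarrow> mconf" where "mstep' \<equiv> mstep ((!) is)"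

definition ok :: "mconf \<Rightarrow> bool" where
  "ok c = (case c of (l, x, y) \<Rightarrow> case is ! l of (a, b, _) \<Rightarrow> 0 \<le> int x + a \<and> 0 \<le> int y + b)"

lemma states1_S: "states1 S = {3 * l |l. l < length is}"
  by (auto simp: machine_vass_def)

lemma statesP_S: "statesP S = insert 1 (\<Union>l\<in>{1..<length is}. {3 * l + 1, 3 * l + 2})"
  by (auto simp: machine_vass_def)

lemma states_S: "states S = states1 S \<union> statesP S"
  by (simp add: machine_vass_def)

lemma trans_S: "trans S = {(0, [0, 0], 0), (1, [0, 0], 1)} \<union> (\<Union>l\<in>{1..<length is}. set (gadget is l))"
  unfolding machine_vass_def vass_of.simps vass.simps fst_image_map_remdups by auto

lemma weight_S: "t \<in> trans S \<Longrightarrow> weight S t = 1"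
  unfolding machine_vass_def by (rule weight_vass_of_const)

lemma vass_mdp_S: "vass_mdp 2 S"
proof -
  have "trans S \<subseteq> states S \<times> {z. length z = 2} \<times> states S"
  proof -
    have "set (gadget is l) \<subseteq> states S \<times> {z. length z = 2} \<times> states S"
      if "l \<in> {1..<length is}" for l
    proof -
      obtain a b q q' where i: "is ! l = (a, b, q, q')" by (metis prod.collapse)
      then have "q < length is" "q' < length is" using that targets[of a b q q'] by (metis atLeastLessThan_iff nth_mem)+
      with i that show ?thesis
        unfolding gadget_def states_S states1_S statesP_S by auto
    qed
    moreover have "0 \<in> states S" "1 \<in> states S"
      using length_gt_1 unfolding states_S states1_S statesP_S by auto
    ultimately show ?thesis unfolding trans_S by (intro Un_least UN_least) simp_all
  qed
  moreover have "states1 S \<inter> statesP S = {}"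
    unfolding states1_S statesP_S by auto presburger+
  moreover have "finite (states S)" "finite (trans S)"
    unfolding states_S states1_S statesP_S trans_S by auto
  ultimately show ?thesis
    unfolding vass_mdp_def using weight_S states_S by auto
qed

lemma p_vass_mdp_S: "p_vass_mdp 2 S"
proof -
  have "z = [0, 0]" if "(q, z, q') \<in> trans S" "q \<in> states1 S" for q z q'
    using that unfolding trans_S states1_S gadget_def
    by (auto split: prod.splits) presburger+
  then show ?thesis
    using vass_mdp_S by (auto simp: p_vass_mdp_def numeral_2_eq_2)
qed

lemma confsE:
  assumes "c \<in> confs M"
  obtains (halt) x y where "c = (0, [x, y])" "c \<in> confs1 M"
    | (sink) x y where "c = (1, [x, y])" "c \<in> confsP M"
    | (player) l x y where "0 < l" "l < length is" "c = (3 * l, [x, y])" "c \<in> confs1 M"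
    | (enabled) l x y where "0 < l" "l < length is" "c = (3 * l + 1, [x, y])" "c \<in> confsP M"
    | (disabled) l x y where "0 < l" "l < length is" "c = (3 * l + 2, [x, y])" "c \<in> confsP M"
proof -
  obtain s x y where c: "c = (s, [x, y])" "s \<in> states S"
    using assms by (cases c) (auto simp: induced_mdp_def length_Suc_conv numeral_2_eq_2)
  then consider "s \<in> states1 S" | "s \<in> statesP S" unfolding states_S by blast
  then show thesis
  proof cases
    case 1
    then have "c \<in> confs1 M" using c by (simp add: induced_mdp_def)
    with 1 c halt player show thesis unfolding states1_S by fastforce
  next
    case 2
    then have "c \<in> confsP M" using c by (simp add: induced_mdp_def)
    with 2 c sink enabled disabled show thesis unfolding statesP_S by fastforce
  qed
qed

section \<open>The enabled transitions in each kind of state\<close>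

lemma enabled_iff:
  "(q, z, q') \<in> enabled S (s, [x, y]) \<longleftrightarrow>
    (q, z, q') \<in> trans S \<and> q = s \<and> (\<forall>i\<in>set (vec_add [x, y] z). i \<ge> 0)"
  by (auto simp: enabled_def)

lemma in_trans_0:
  assumes "q div 3 = 0"
  shows "(q, z, q') \<in> trans S \<longleftrightarrow> (q, z, q') \<in> {(0, [0, 0], 0), (1, [0, 0], 1)}"
proof
  assume "(q, z, q') \<in> trans S"
  moreover have "l = 0" if "(q, z, q') \<in> set (gadget is l)" for l
    using gadget_div[OF that] assms by simp
  ultimately show "(q, z, q') \<in> {(0, [0, 0], 0), (1, [0, 0], 1)}"
    unfolding trans_S by fastforce
qed (auto simp: trans_S)

lemma in_trans_gadget:
  assumes "0 < l" "l < length is" "q div 3 = l"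
  shows "(q, z, q') \<in> trans S \<longleftrightarrow> (q, z, q') \<in> set (gadget is l)"
proof
  assume "(q, z, q') \<in> trans S"
  moreover have "(q, z, q') \<notin> {(0, [0, 0], 0), (1, [0, 0], 1)}" using assms by auto
  ultimately obtain l' where l': "(q, z, q') \<in> set (gadget is l')" unfolding trans_S by blast
  with gadget_div[OF l'] assms show "(q, z, q') \<in> set (gadget is l)" by simp
next
  assume "(q, z, q') \<in> set (gadget is l)"
  moreover have "l \<in> {1..<length is}" using assms by simp
  ultimately show "(q, z, q') \<in> trans S" unfolding trans_S by blast
qed

lemma enabled_halt: "enabled S (0, [x, y]) = {(0, [0, 0], 0)}"
proof -
  have "t \<in> enabled S (0, [x, y]) \<longleftrightarrow> t = (0, [0, 0], 0)" for t
    by (cases t) (auto simp: enabled_iff in_trans_0 vec_add_def)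
  then show ?thesis by blast
qed

lemma enabled_sink: "enabled S (1, [x, y]) = {(1, [0, 0], 1)}"
proof -
  have "t \<in> enabled S (1, [x, y]) \<longleftrightarrow> t = (1, [0, 0], 1)" for t
    by (cases t) (auto simp: enabled_iff in_trans_0 vec_add_def)
  then show ?thesis by blast
qed

context
  fixes l a b q q' assumes l: "0 < l" "l < length is" and instr: "is ! l = (a, b, q, q')"
begin

lemma enabled_player:
  "enabled S (3 * l, [x, y]) = {(3 * l, [0, 0], 3 * l + 1), (3 * l, [0, 0], 3 * l + 2)}"
proof -
  have "t \<in> enabled S (3 * l, [x, y]) \<longleftrightarrow> t \<in> set (gadget is l) \<and> fst t = 3 * l \<and>
      (\<forall>i\<in>set (vec_add [x, y] (fst (snd t))). i \<ge> 0)" for t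
    using in_trans_gadget[OF l, of "3 * l"] by (cases t) (auto simp: enabled_iff)
  then show ?thesis
    by (auto simp: gadget_def instr vec_add_def; presburger)
qed

lemma enabled_enabled:
  "enabled S (3 * l + 1, [x, y]) = insert (3 * l + 1, [0, 0], 3 * l + 1)
     (if ok (l, x, y) then {(3 * l + 1, [a, b], 3 * q)} else {})"
proof -
  have "t \<in> enabled S (3 * l + 1, [x, y]) \<longleftrightarrow> t \<in> set (gadget is l) \<and> fst t = 3 * l + 1 \<and>
      (\<forall>i\<in>set (vec_add [x, y] (fst (snd t))). i \<ge> 0)" for t
    using in_trans_gadget[OF l, of "3 * l + 1"] by (cases t) (auto simp: enabled_iff)
  then show ?thesis
    by (auto simp: gadget_def instr vec_add_def ok_def; presburger)
qed

lemma enabled_disabled: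
  "enabled S (3 * l + 2, [x, y]) = insert (3 * l + 2, [0, 0], 3 * q')
     (if ok (l, x, y) then {(3 * l + 2, [a, b], 1)} else {})"
proof -
  have "t \<in> enabled S (3 * l + 2, [x, y]) \<longleftrightarrow> t \<in> set (gadget is l) \<and> fst t = 3 * l + 2 \<and>
      (\<forall>i\<in>set (vec_add [x, y] (fst (snd t))). i \<ge> 0)" for t
    using in_trans_gadget[OF l, of "3 * l + 2"] by (cases t) (auto simp: enabled_iff)
  then show ?thesis
    by (auto simp: gadget_def instr vec_add_def ok_def; presburger)
qed

lemma mstep_instr:
  "mstep' (l, x, y) = (if ok (l, x, y) then (q, nat (int x + a), nat (int y + b)) else (q', x, y))"
  by (simp add: instr ok_def)

end

lemma target_zero: "target (s, [x, y]) (s, [0, 0], s') = (s', [x, y])"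
  by (simp add: target_def vec_add_def)

lemma target_Cons: "target (s, [x, y]) (s, [a, b], s') = (s', [nat (int x + a), nat (int y + b)])"
  by (simp add: target_def vec_add_def)

lemma step_target: "c \<in> confs M \<Longrightarrow> t \<in> enabled S c \<Longrightarrow> step M c (target c t)"
  by (auto simp: induced_mdp_def)

text \<open>Every state has an outgoing transition with vector \<open>[0, 0]\<close>, which is
  enabled for all counter values.\<close>

lemma deadlock_free_S: "deadlock_free 2 S"
  unfolding deadlock_free_def
proof
  fix c assume c: "c \<in> confs M"
  then have "enabled S c \<noteq> {}"
  proof (cases rule: confsE)
    case (sink x y)
    then show ?thesis using enabled_sink by simp
  next
    case (player l x y)
    obtain a b q q' where "is ! l = (a, b, q, q')" by (metis prod.collapse)
    with player show ?thesis using enabled_player by auto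
  next
    case (enabled l x y)
    obtain a b q q' where "is ! l = (a, b, q, q')" by (metis prod.collapse)
    with enabled show ?thesis using enabled_enabled by auto
  next
    case (disabled l x y)
    obtain a b q q' where "is ! l = (a, b, q, q')" by (metis prod.collapse)
    with disabled show ?thesis using enabled_disabled by auto
  qed (simp add: enabled_halt)
  then obtain t where "t \<in> enabled S c" by blast
  with c show "\<exists>c'. step M c c'" using step_target by blast
qed

lemma repeated_reach_S: "repeated_reach 2 S 0 = reach 2 S 0"
proof
  show "repeated_reach 2 S 0 \<subseteq> reach 2 S 0"
    by (auto simp: repeated_reach_def reach_def INFM_nat)
  show "reach 2 S 0 \<subseteq> repeated_reach 2 S 0"
  proof
    fix \<omega> assume "\<omega> \<in> reach 2 S 0"
    then obtain i where \<omega>: "\<omega> \<in> plays M" "fst (\<omega> i) = 0" by (auto simp: reach_def)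
    have "fst (\<omega> (i + j)) = 0" for j
    proof (induction j)
      case (Suc j)
      have "\<omega> (i + j) \<in> confs M" "step M (\<omega> (i + j)) (\<omega> (i + Suc j))" using \<omega>(1) by (auto simp: plays_def)
      from this(1) this(2) Suc show ?case
        by (cases rule: confsE) (auto simp: induced_mdp_def enabled_halt target_zero)
    qed (simp add: \<omega>)
    then have "\<exists>n\<ge>m. fst (\<omega> n) = 0" for m by (intro exI[of _ "i + m"]) simp
    with \<omega>(1) show "\<omega> \<in> repeated_reach 2 S 0" by (simp add: repeated_reach_def INFM_nat_le)
  qed
qed


section \<open>Expected values after one probabilistic step\<close>

definition "average U c = (\<Sum>t\<in>enabled S c. U (target c t) :: ennreal) / of_nat (card (enabled S c))"

lemma average_sink: "average U (1, [x, y]) = U (1, [x, y])"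
  by (simp only: average_def enabled_sink) (simp add: target_zero ennreal_divide_one)

lemma average_enabled:
  assumes "0 < l" "l < length is"
  shows "average U (3 * l + 1, [x, y]) =
    (if ok (l, x, y) then (U (3 * l + 1, [x, y]) + U (emb (mstep' (l, x, y)))) / 2
     else U (3 * l + 1, [x, y]))"
proof -
  obtain a b q q' where i: "is ! l = (a, b, q, q')" by (metis prod.collapse)
  \<comment> \<open>The two enabled transitions are thus distinct even if \<open>a = b = 0\<close>,
    and the denominator is \<open>2\<close>.\<close>
  have "3 * l + 1 \<noteq> 3 * q" by presburger
  then show ?thesis
    unfolding average_def enabled_enabled[OF assms i] mstep_instr[OF assms i] emb_def
    by (simp add: target_zero target_Cons ennreal_divide_one)
qed

text \<open>Only the weight \<open>1/2\<close> on the sink matters for punishing a false claim, so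
  the other successor stays anonymous, but chosen independently of \<open>U\<close>.\<close>

lemma average_disabled_ok:
  assumes "0 < l" "l < length is" "ok (l, x, y)"
  shows "\<exists>v c. \<forall>U. average U (3 * l + 2, [x, y]) = (U (1, v) + U c) / 2"
proof -
  obtain a b q q' where i: "is ! l = (a, b, q, q')" by (metis prod.collapse)
  have "1 \<noteq> 3 * q'" by presburger
  then have "average U (3 * l + 2, [x, y]) =
      (U (1, [nat (int x + a), nat (int y + b)]) + U (3 * q', [x, y])) / 2" for U
    using assms(3) unfolding average_def enabled_disabled[OF assms(1,2) i]
    by (simp add: target_zero target_Cons add.commute)
  then show ?thesis by blast
qed

lemma average_disabled_not_ok:
  assumes "0 < l" "l < length is" "\<not> ok (l, x, y)"
  shows "average U (3 * l + 2, [x, y]) = U (emb (mstep' (l, x, y)))"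
proof -
  obtain a b q q' where i: "is ! l = (a, b, q, q')" by (metis prod.collapse)
  from assms(3) show ?thesis
    unfolding average_def enabled_disabled[OF assms(1,2) i] mstep_instr[OF assms(1,2) i] emb_def
    by (simp add: target_zero ennreal_divide_one)
qed

lemma step_player:
  assumes "0 < l" "l < length is" "step M (3 * l, [x, y]) c"
  shows "c = (3 * l + 1, [x, y]) \<or> c = (3 * l + 2, [x, y])"
proof -
  obtain a b q q' where i: "is ! l = (a, b, q, q')" by (metis prod.collapse)
  from assms(3) show ?thesis
    unfolding induced_mdp_def mdp.simps enabled_player[OF assms(1,2) i]
    by (auto simp: target_zero)
qed

lemma step_halt: "step M (0, [x, y]) c \<Longrightarrow> c = (0, [x, y])"
  by (auto simp: induced_mdp_def enabled_halt target_zero)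

lemma not_confs1_and_confsP: "c \<in> confs1 M \<Longrightarrow> c \<notin> confsP M"
  using vass_mdp_S by (auto simp: induced_mdp_def vass_mdp_def)

lemma confsP_subset: "c \<in> confsP M \<Longrightarrow> c \<in> confs M"
  unfolding induced_mdp_def mdp.simps states_S by blast

lemma last_confs: "finite_play M w \<Longrightarrow> last w \<in> confs M"
  by (auto simp: finite_play_def)

lemma strategy_step: "strategy M \<sigma> \<Longrightarrow> finite_play M w \<Longrightarrow> last w \<in> confs1 M \<Longrightarrow> step M (last w) (\<sigma> w)"
  by (simp add: strategy_def)

section \<open>The strategy of honest claims\<close>

definition faithful :: "nat conf list \<Rightarrow> nat conf" where
  "faithful w = (case last w of (s, v) \<Rightarrow>
     if s = 0 then (0, v) else if ok (s div 3, v ! 0, v ! 1) then (s + 1, v) else (s + 2, v))"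

lemma faithful_halt: "last w = (0, v) \<Longrightarrow> faithful w = (0, v)"
  by (simp add: faithful_def)

lemma faithful_player:
  "last w = (3 * l, [x, y]) \<Longrightarrow> 0 < l \<Longrightarrow>
     faithful w = (if ok (l, x, y) then (3 * l + 1, [x, y]) else (3 * l + 2, [x, y]))"
  by (simp add: faithful_def)

lemma strategy_faithful: "strategy M faithful"
  unfolding strategy_def
proof (intro allI impI)
  fix w assume w: "finite_play M w \<and> last w \<in> confs1 M"
  then have c: "last w \<in> confs M" by (simp add: last_confs)
  then show "step M (last w) (faithful w)"
  proof (cases rule: confsE)
    case (halt x y)
    have "(0, [0, 0], 0) \<in> enabled S (last w)" using halt by (simp add: enabled_halt)
    from step_target[OF c this] halt show ?thesis by (simp add: target_zero faithful_halt)
  next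
    case (player l x y)
    obtain a b q q' where i: "is ! l = (a, b, q, q')" by (metis prod.collapse)
    have "(3 * l, [0, 0], 3 * l + 1) \<in> enabled S (last w)" "(3 * l, [0, 0], 3 * l + 2) \<in> enabled S (last w)"
      unfolding player(3) enabled_player[OF player(1,2) i] by simp_all
    from step_target[OF c this(1)] step_target[OF c this(2)] show ?thesis
      unfolding player(3) faithful_player[OF player(3,1)] target_zero by simp
  qed (use w not_confs1_and_confsP in auto)
qed

lemma superharmonic_average:
  assumes "strategy M \<sigma>" "z \<le> a * z"
    "\<And>c. c \<in> confsP M \<Longrightarrow> average U c \<le> a * U c"
    "\<And>w. finite_play M w \<Longrightarrow> last w \<in> confs1 M \<Longrightarrow> U (\<sigma> w) \<le> a * U (last w)"
  shows "superharmonic M c0 \<sigma> a (\<lambda>w. if finite_play M w then U (last w) else z)"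
  by (rule superharmonic_confs[OF vass_mdp_S weight_S deadlock_free_S assms(1,2)])
    (use assms(3,4) in \<open>simp_all add: average_def\<close>)

section \<open>Halting machines: a value that contracts under honest claims\<close>

definition halts_from :: "mconf \<Rightarrow> bool" where
  "halts_from c \<longleftrightarrow> (\<exists>m. fst ((mstep' ^^ m) c) = 0)"

definition halting_time :: "mconf \<Rightarrow> nat" where
  "halting_time c = (LEAST m. fst ((mstep' ^^ m) c) = 0)"

lemma halts_from_mstep: "fst c \<noteq> 0 \<Longrightarrow> halts_from (mstep' c) = halts_from c"
  unfolding halts_from_def by (metis funpow_0 funpow_Suc_right not0_implies_Suc o_apply)

lemma halting_time_mstep:
  assumes "fst c \<noteq> 0" "halts_from c"
  shows "halting_time c = Suc (halting_time (mstep' c))"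
proof -
  obtain m where "fst ((mstep' ^^ m) c) = 0" using assms(2) by (auto simp: halts_from_def)
  from Least_Suc[of "\<lambda>m. fst ((mstep' ^^ m) c) = 0", OF this] assms(1) show ?thesis
    unfolding halting_time_def by (simp add: funpow_Suc_right del: funpow.simps(2))
qed

text \<open>The value \<open>0\<close> at label \<open>0\<close> makes "below \<open>1\<close>"
  equivalent to having halted: elsewhere the value is at least \<open>4\<close>, and still at least
  \<open>2\<close> after a claim. Infinity for runs that never halt keeps
  \<open>time_value_mstep\<close> free of a halting assumption.\<close>

definition time_value :: "mconf \<Rightarrow> ennreal" where
  "time_value c = (if fst c = 0 then 0 else if halts_from c then ennreal (4 ^ halting_time c) else \<infinity>)"

lemma time_value_mstep:
  assumes "fst c \<noteq> 0"
  shows "4 * time_value (mstep' c) \<le> time_value c"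
proof (cases "halts_from c")
  case True
  with assms show ?thesis
    using halts_from_mstep[OF assms] halting_time_mstep[OF assms True]
    by (simp add: time_value_def ennreal_mult del: mstep.simps flip: ennreal_numeral)
next
  case False
  with assms show ?thesis by (simp add: time_value_def)
qed

lemma time_value_ge: "fst c \<noteq> 0 \<Longrightarrow> 4 \<le> time_value c"
proof -
  assume c: "fst c \<noteq> 0"
  have "(4::real) \<le> 4 ^ halting_time c" if "halts_from c"
    using halting_time_mstep[OF c that] by simp
  then show ?thesis
    using c by (auto simp: time_value_def simp flip: ennreal_numeral intro!: ennreal_leI)
qed

text \<open>The power of \<open>4\<close> leaves room for two play steps per machine step; the value
  \<open>\<infinity>\<close> marks the configurations that honest claims avoid.\<close>

definition faithful_value :: "nat conf \<Rightarrow> ennreal" where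
  "faithful_value c = (case c of (s, v) \<Rightarrow> let m = (s div 3, v ! 0, v ! 1) in
     if s = 1 then \<infinity> else if s mod 3 = 0 then time_value m
     else if (s mod 3 = 1) = ok m then time_value m / 2 else \<infinity>)"

lemma faithful_value_emb: "faithful_value (emb m) = time_value m"
proof -
  have "(3 * l) mod 3 = (0::nat)" "3 * l \<noteq> 1" for l :: nat by presburger+
  then show ?thesis by (cases m) (simp add: faithful_value_def emb_def)
qed

lemma faithful_value_simps:
  "faithful_value (3 * l, [x, y]) = time_value (l, x, y)"
  "faithful_value (1, v) = \<infinity>"
  "0 < l \<Longrightarrow> faithful_value (3 * l + 1, [x, y]) = (if ok (l, x, y) then time_value (l, x, y) / 2 else \<infinity>)"
  "0 < l \<Longrightarrow> faithful_value (3 * l + 2, [x, y]) = (if ok (l, x, y) then \<infinity> else time_value (l, x, y) / 2)"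
proof -
  have "3 * l \<noteq> 1" by presburger
  then show "faithful_value (3 * l, [x, y]) = time_value (l, x, y)" by (simp add: faithful_value_def)
  show "faithful_value (1, v) = \<infinity>" by (simp add: faithful_value_def)
  have *: "(3 * l + 1) div 3 = l" "(3 * l + 1) mod 3 = 1" "(3 * l + 2) div 3 = l" "(3 * l + 2) mod 3 = 2"
    by presburger+
  assume "0 < l"
  then show "faithful_value (3 * l + 1, [x, y]) = (if ok (l, x, y) then time_value (l, x, y) / 2 else \<infinity>)"
    and "faithful_value (3 * l + 2, [x, y]) = (if ok (l, x, y) then \<infinity> else time_value (l, x, y) / 2)"
    unfolding faithful_value_def prod.case Let_def * by simp_all
qed

lemma average_faithful_value:
  assumes "c \<in> confsP M"
  shows "average faithful_value c \<le> ennreal (3 / 4) * faithful_value c"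
  using confsP_subset[OF assms]
proof (cases rule: confsE)
  case (sink x y)
  then show ?thesis unfolding sink(1) faithful_value_simps by (simp add: ennreal_mult_top)
next
  case (enabled l x y)
  have "4 * time_value (mstep' (l, x, y)) \<le> time_value (l, x, y)"
    by (rule time_value_mstep) (use enabled in simp)
  from ennreal_value_bounds(1)[OF this] show ?thesis
    unfolding enabled(3) average_enabled[OF enabled(1,2)] faithful_value_emb
      faithful_value_simps(3)[OF enabled(1)] by (simp add: ennreal_mult_top)
next
  case (disabled l x y)
  have *: "4 * time_value (mstep' (l, x, y)) \<le> time_value (l, x, y)"
    by (rule time_value_mstep) (use disabled in simp)
  show ?thesis
  proof (cases "ok (l, x, y)")
    case True
    then show ?thesis
      unfolding disabled(3) faithful_value_simps(4)[OF disabled(1)] by (simp add: ennreal_mult_top)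
  next
    case False
    with ennreal_value_bounds(2)[OF *] show ?thesis
      unfolding disabled(3) average_disabled_not_ok[OF disabled(1,2) False] faithful_value_emb
        faithful_value_simps(4)[OF disabled(1)] by simp
  qed
qed (use assms not_confs1_and_confsP in auto)

lemma faithful_value_faithful:
  assumes "finite_play M w" "last w \<in> confs1 M"
  shows "faithful_value (faithful w) \<le> ennreal (3 / 4) * faithful_value (last w)"
  using last_confs[OF assms(1)]
proof (cases rule: confsE)
  case (halt x y)
  have "faithful_value (0, [x, y]) = 0" by (simp add: faithful_value_def time_value_def)
  then show ?thesis using halt faithful_halt[OF halt(1)] by simp
next
  case (player l x y)
  show ?thesis
    unfolding player(3) faithful_player[OF player(3,1)] faithful_value_simps(1)
    using ennreal_value_bounds(3)[of 0 "time_value (l, x, y)"] faithful_value_simps(3,4)[OF player(1)]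
    by simp
qed (use assms(2) not_confs1_and_confsP in auto)

lemma faithful_value_ge:
  assumes "c \<in> confs M" "faithful_value c < 1"
  shows "fst c = 0"
  using assms(1)
proof (cases rule: confsE)
  case (sink x y)
  with assms(2) show ?thesis unfolding sink(1) faithful_value_simps by simp
next
  case (player l x y)
  have "4 \<le> time_value (l, x, y)" by (rule time_value_ge) (use player in simp)
  with assms(2) show ?thesis unfolding player(3) faithful_value_simps by (auto dest: order.strict_trans1)
next
  case (enabled l x y)
  have "4 \<le> time_value (l, x, y)" by (rule time_value_ge) (use enabled in simp)
  with assms(2) show ?thesis unfolding enabled(3) faithful_value_simps(3)[OF enabled(1)]
    using half_ge_1[of "time_value (l, x, y)"] by (auto simp: not_less split: if_splits)
next
  case (disabled l x y)
  have "4 \<le> time_value (l, x, y)" by (rule time_value_ge) (use disabled in simp)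
  with assms(2) show ?thesis unfolding disabled(3) faithful_value_simps(4)[OF disabled(1)]
    using half_ge_1[of "time_value (l, x, y)"] by (auto simp: not_less split: if_splits)
qed simp

lemma measure_reach_faithful:
  assumes start: "emb m \<in> confs M" and "halts_from m"
  shows "measure (play_measure M (emb m) faithful) (reach 2 S 0) = 1"
proof -
  let ?V = "\<lambda>w. if finite_play M w then faithful_value (last w) else \<infinity>"
  have sh: "superharmonic M (emb m) faithful (ennreal (3 / 4)) ?V"
    by (rule superharmonic_average[OF strategy_faithful])
      (simp_all add: ennreal_mult_top average_faithful_value faithful_value_faithful)
  have "faithful_value (emb m) < \<infinity>"
    using assms by (simp add: faithful_value_emb time_value_def)
  moreover have "finite_play M [emb m]" using start by (simp add: finite_play_def)
  ultimately have fin: "?V [emb m] < \<infinity>" by simp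
  have V: "finite_play M w \<and> fst (last w) = 0" if "?V w < 1" for w
    using that faithful_value_ge[OF last_confs, of w] by (auto split: if_splits)
  show ?thesis
    unfolding reach_def
    by (rule measure_reach_eq_1[OF sh fin _ _ V]) (use reach_in_sets(1)[of 2 S 0] in \<open>simp_all add: reach_def\<close>)
qed

text \<open>Here \<open>R\<close> is the infinite run of a machine that does not halt; outside of it the trivial
  bound \<open>1\<close> on the probability of winning is harmless.\<close>

definition stuck_value :: "mconf set \<Rightarrow> nat conf \<Rightarrow> ennreal" where
  "stuck_value R c = (case c of (s, v) \<Rightarrow> let m = (s div 3, v ! 0, v ! 1) in
     if s = 1 \<or> s mod 3 = 1 \<and> \<not> ok m \<and> m \<in> R then 0 else if m \<in> R then 1 / 2 else 1)"

section \<open>Machines that do not halt: a value that no strategy increases\<close>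

lemma half_le_one: "1 / 2 \<le> (1::ennreal)"
  using half_sum_le[of 0 1 1] by simp

lemma stuck_value_le_1: "stuck_value R c \<le> 1"
  using half_le_one by (auto simp: stuck_value_def Let_def split: prod.splits)

lemma stuck_value_simps:
  "stuck_value R (3 * l, [x, y]) = (if (l, x, y) \<in> R then 1 / 2 else 1)"
  "stuck_value R (1, v) = 0"
  "0 < l \<Longrightarrow> stuck_value R (3 * l + 1, [x, y]) =
     (if (l, x, y) \<in> R then if ok (l, x, y) then 1 / 2 else 0 else 1)"
  "stuck_value R (3 * l + 2, [x, y]) = (if (l, x, y) \<in> R then 1 / 2 else 1)"
proof -
  have "3 * l \<noteq> 1" by presburger
  then show "stuck_value R (3 * l, [x, y]) = (if (l, x, y) \<in> R then 1 / 2 else 1)"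
    by (simp add: stuck_value_def)
  show "stuck_value R (1, v) = 0" by (simp add: stuck_value_def)
  have *: "(3 * l + 1) div 3 = l" "(3 * l + 1) mod 3 = 1" "(3 * l + 2) div 3 = l" "(3 * l + 2) mod 3 = 2"
    by presburger+
  show "stuck_value R (3 * l + 2, [x, y]) = (if (l, x, y) \<in> R then 1 / 2 else 1)"
    unfolding stuck_value_def prod.case Let_def * by simp
  assume "0 < l"
  then show "stuck_value R (3 * l + 1, [x, y]) =
      (if (l, x, y) \<in> R then if ok (l, x, y) then 1 / 2 else 0 else 1)"
    unfolding stuck_value_def prod.case Let_def * by simp
qed

lemma stuck_value_emb: "stuck_value R (emb m) = (if m \<in> R then 1 / 2 else 1)"
  by (cases m) (simp only: emb_def prod.case stuck_value_simps)

text \<open>True claims stay on \<open>R\<close>, which is closed under steps. After a false claim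
  "enabled" only the loop remains, with value \<open>0\<close>; after a false claim "disabled" the
  sink contributes \<open>0\<close> with weight \<open>1/2\<close>.\<close>

lemma average_stuck_value:
  assumes "c \<in> confsP M" and closed: "\<And>m. m \<in> R \<Longrightarrow> mstep' m \<in> R"
  shows "average (stuck_value R) c \<le> stuck_value R c"
  using confsP_subset[OF assms(1)]
proof (cases rule: confsE)
  case (sink x y)
  then show ?thesis by (simp only: average_sink order_refl)
next
  case (enabled l x y)
  let ?m = "(l, x, y)"
  have le: "stuck_value R (emb (mstep' ?m)) \<le> (if ?m \<in> R then 1 / 2 else 1)"
    unfolding stuck_value_emb using closed[of ?m] half_le_one by (auto simp del: mstep.simps)
  show ?thesis
  proof (cases "ok ?m")
    case True
    then have "stuck_value R (3 * l + 1, [x, y]) = (if ?m \<in> R then 1 / 2 else 1)"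
      unfolding stuck_value_simps(3)[OF enabled(1)] by simp
    with half_sum_le[OF order_refl le] True show ?thesis
      unfolding enabled(3) average_enabled[OF enabled(1,2)] by simp
  next
    case False
    then show ?thesis unfolding enabled(3) average_enabled[OF enabled(1,2)] by simp
  qed
next
  case (disabled l x y)
  let ?m = "(l, x, y)"
  show ?thesis
  proof (cases "ok ?m")
    case True
    obtain v c' where "\<forall>U. average U (3 * l + 2, [x, y]) = (U (1, v) + U c') / 2"
      using average_disabled_ok[OF disabled(1,2) True] by blast
    then have "average (stuck_value R) c = (stuck_value R (1, v) + stuck_value R c') / 2"
      unfolding disabled(3) by blast
    also have "\<dots> = stuck_value R c' / 2"
      unfolding stuck_value_simps(2) by simp
    \<comment> \<open>The surviving branch may leave \<open>R\<close>, where only the bound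
      \<open>1\<close> is available; halving it just matches the value on \<open>R\<close>.\<close>
    also have "\<dots> \<le> 1 / 2" by (intro divide_right_mono_ennreal stuck_value_le_1)
    also have "\<dots> \<le> stuck_value R c"
      unfolding disabled(3) stuck_value_simps(4) using half_le_one by simp
    finally show ?thesis .
  next
    case False
    show ?thesis
      unfolding disabled(3) average_disabled_not_ok[OF disabled(1,2) False] stuck_value_simps(4)
        stuck_value_emb
      using closed[of ?m] half_le_one by (auto simp del: mstep.simps)
  qed
qed (use assms not_confs1_and_confsP in auto)

text \<open>Neither claim raises the value, so memory cannot help Player 1 although
  \<open>\<sigma>\<close> may depend on the whole history.\<close>

lemma stuck_value_strategy:
  assumes "strategy M \<sigma>" "finite_play M w" "last w \<in> confs1 M"
  shows "stuck_value R (\<sigma> w) \<le> stuck_value R (last w)"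
  using last_confs[OF assms(2)]
proof (cases rule: confsE)
  case (halt x y)
  then have "\<sigma> w = last w" using strategy_step[OF assms] step_halt by simp
  then show ?thesis by simp
next
  case (player l x y)
  from strategy_step[OF assms] have "\<sigma> w = (3 * l + 1, [x, y]) \<or> \<sigma> w = (3 * l + 2, [x, y])"
    unfolding player(3) by (rule step_player[OF player(1,2)])
  moreover have "stuck_value R (3 * l + 1, [x, y]) \<le> stuck_value R (3 * l, [x, y])"
    unfolding stuck_value_simps(1) stuck_value_simps(3)[OF player(1)] by simp
  moreover have "stuck_value R (3 * l + 2, [x, y]) \<le> stuck_value R (3 * l, [x, y])"
    unfolding stuck_value_simps by simp
  ultimately show ?thesis unfolding player(3) by metis
qed (use assms(3) not_confs1_and_confsP in auto)

lemma finite_play_halted: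
  "finite_play M w \<Longrightarrow> c \<in> set w \<Longrightarrow> fst c = 0 \<Longrightarrow> fst (last w) = 0"
proof (induction w rule: rev_induct)
  case (snoc d w)
  show ?case
  proof (cases "c = d")
    case False
    then have w: "w \<noteq> []" "c \<in> set w" using snoc.prems by auto
    then have "finite_play M w" "step M (last w) d" using snoc.prems by (auto simp: finite_play_snoc)
    with snoc w have "fst (last w) = 0" by blast
    with last_confs[OF \<open>finite_play M w\<close>] \<open>step M (last w) d\<close> show ?thesis
      by (cases rule: confsE) (auto dest: step_halt)
  qed (use snoc.prems in simp)
qed simp

text \<open>The run from \<open>m\<close> is closed under steps and avoids label \<open>0\<close>;
  hence the value is \<open>1/2\<close> at the start and \<open>1\<close> at the halting
  state.\<close>

lemma measure_reach_le_half:
  assumes "\<not> halts_from m" "strategy M \<sigma>" "emb m \<in> confs M"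
  shows "measure (play_measure M (emb m) \<sigma>) (reach 2 S 0) \<le> 1 / 2"
proof -
  let ?R = "{c. reaches ((!) is) m c}"
  let ?V = "\<lambda>w. if finite_play M w then stuck_value ?R (last w) else 0"
  have closed: "mstep' c \<in> ?R" if "c \<in> ?R" for c
    using that reaches_trans[OF _ reaches_step[OF refl]] by blast
  have nonzero: "fst c \<noteq> 0" if "c \<in> ?R" for c
    using that assms(1) by (auto simp: reaches_def halts_from_def)
  have sh: "superharmonic M (emb m) \<sigma> 1 ?V"
    by (rule superharmonic_average[OF assms(2)])
      (use average_stuck_value[OF _ closed] stuck_value_strategy[OF assms(2)] in simp_all)
  have "?V [emb m] = 1 / 2"
    using assms(3) by (simp add: finite_play_def stuck_value_emb reaches_refl)
  then have start: "?V [emb m] \<le> ennreal (1 / 2)"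
    using ennreal_divide_2[of 1] by simp
  have goal: "1 \<le> ?V w" if "finite_play M w" "c \<in> set w" "fst c = 0" for w c
  proof -
    have "fst (last w) = 0" using that by (rule finite_play_halted)
    \<comment> \<open>The form \<open>3 * 0\<close> lets \<open>stuck_value_simps\<close>
      apply.\<close>
    with last_confs[OF that(1)] obtain x y where last: "last w = (3 * 0, [x, y])"
      by (cases rule: confsE) auto
    have "(0, x, y) \<notin> ?R" using nonzero by fastforce
    with that(1) show ?thesis unfolding last stuck_value_simps by simp
  qed
  show ?thesis
    unfolding reach_def by (rule measure_reach_le[OF sh start]) (use goal in simp_all)
qed

section \<open>Equivalence of the winning conditions with halting\<close>

lemma start_confs: "emb (1, n, 0) \<in> confs M"
  using length_gt_1 unfolding emb_def induced_mdp_def mdp.simps states_S states1_S by auto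

lemma almost_sure_iff:
  "almost_sure M (emb (1, n, 0)) (reach 2 S 0) \<longleftrightarrow> halts_from (1, n, 0)"
proof
  assume "almost_sure M (emb (1, n, 0)) (reach 2 S 0)"
  then obtain \<sigma> where "strategy M \<sigma>" "measure (play_measure M (emb (1, n, 0)) \<sigma>) (reach 2 S 0) = 1"
    by (auto simp: almost_sure_def)
  then show "halts_from (1, n, 0)" using measure_reach_le_half[OF _ _ start_confs, of n \<sigma>] by force
next
  assume "halts_from (1, n, 0)"
  from measure_reach_faithful[OF start_confs this] strategy_faithful
  show "almost_sure M (emb (1, n, 0)) (reach 2 S 0)" by (auto simp: almost_sure_def)
qed

text \<open>The supremum is attained by \<open>faithful\<close> if the machine halts and is at most
  \<open>1/2\<close> otherwise; \<open>faithful\<close> also shows that the set of strategies is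
  nonempty, as the supremum requires.\<close>

lemma limit_sure_iff:
  "limit_sure M (emb (1, n, 0)) (reach 2 S 0) \<longleftrightarrow> halts_from (1, n, 0)"
proof -
  let ?p = "\<lambda>\<sigma>. measure (play_measure M (emb (1, n, 0)) \<sigma>) (reach 2 S 0)"
  have le_1: "?p \<sigma> \<le> 1" for \<sigma>
    by (rule prob_space.prob_le_1[OF prob_space_play_measure])
  have "(SUP \<sigma>\<in>{\<sigma>. strategy M \<sigma>}. ?p \<sigma>) = 1" if "halts_from (1, n, 0)"
    using strategy_faithful measure_reach_faithful[OF start_confs that] le_1
    by (intro cSup_eq_maximum) (auto intro!: image_eqI[of _ _ faithful])
  moreover have "(SUP \<sigma>\<in>{\<sigma>. strategy M \<sigma>}. ?p \<sigma>) \<le> 1 / 2" if "\<not> halts_from (1, n, 0)"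
    using strategy_faithful measure_reach_le_half[OF that _ start_confs]
    by (intro cSUP_least) auto
  ultimately show ?thesis unfolding limit_sure_def by fastforce
qed

lemma input_S: "(machine_vass is, emb (1, n, 0), 0) \<in> inputs 2"
proof -
  obtain qs1 qsP ts where A: "machine_vass is = (qs1, qsP, ts)" by (metis prod.collapse)
  have "distinct (map fst ts)"
    using A by (auto simp: machine_vass_def comp_def simp del: remdups.simps)
  moreover have "0 \<in> states S"
    using length_gt_1 unfolding states_S states1_S by auto
  ultimately show ?thesis
    using p_vass_mdp_S deadlock_free_S start_confs[of n] unfolding inputs_def A
    by (cases "emb (1, n, 0)") (simp del: vass_of.simps)
qed

end

section \<open>Undecidability\<close>

lemma machine_decide_code: "machine (decide_code h)"
proof
  show "1 < length (decide_code h)" by (simp add: decide_code_def Let_def)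
qed (use decide_code_targets in blast)

definition recf_input_counter :: recf where
  "recf_input_counter =
     Comp recf_mult [Comp (recf_power (nth_prime 0)) [Proj 0],
       Comp recf_mult [Comp (recf_power (nth_prime 1)) [Proj 1],
         Comp (recf_power (nth_prime 2)) [Proj 2]]]"

lemma computes_input_counter: "computes recf_input_counter [a, b, c] (input_counter a b c)"
  unfolding recf_input_counter_def input_counter_def
  by (rule computes_Comp1 computes_Comp2 computes_Proj computes_mult computes_power | simp)+

text \<open>Follows the layout of \<open>input_encode\<close>: state \<open>3\<close> is the start
  label \<open>1\<close>, and the last \<open>0\<close> is the halting state. The instance contains
  its own initial counter value, which is therefore computed from \<open>a\<close>,
  \<open>b\<close>, \<open>c\<close> by \<open>recf_input_counter\<close>.\<close>

definition recf_input :: recf where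
  "recf_input = recf_list [Proj 0, Proj 1, Proj 2, recf_const 3,
     recf_list [recf_input_counter, Zero], Zero]"

lemma computes_input:
  "computes recf_input [a, b, c]
     (list_encode [a, b, c, 3, list_encode [input_counter a b c, 0], 0])"
proof -
  have "computes (recf_list [recf_input_counter, Zero]) [a, b, c] (list_encode [input_counter a b c, 0])"
    by (rule computes_list) (auto intro: computes_input_counter computes.intros(1))
  then show ?thesis
    unfolding recf_input_def
    by (intro computes_list)
      (auto simp del: recf_list.simps list_encode.simps
        intro: computes_Proj computes_const computes.intros(1))
qed

text \<open>The machine that runs a supposed decision procedure on a VASS-MDP given by the registers and
  then does the opposite of its answer is turned into a VASS-MDP, the description of which is put
  into the registers. No recursion theorem is needed since the machine does not depend on them.\<close>

lemma not_decidable: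
  assumes "\<And>is n. machine is \<Longrightarrow>
    P (machine_vass is, (3, [n, 0]), 0) \<longleftrightarrow> machine.halts_from is (1, n, 0)"
  shows "\<not> decidable (inputs 2) input_encode P"
proof
  assume "decidable (inputs 2) input_encode P"
  then obtain f where f: "\<And>x. x \<in> inputs 2 \<Longrightarrow> computes f [input_encode x] (if P x then 1 else 0)"
    by (auto simp: decidable_def)
  define h where "h = Comp f [recf_input]"
  interpret machine "decide_code h" by (rule machine_decide_code)
  obtain qs1 qsP ts where A: "machine_vass (decide_code h) = (qs1, qsP, ts)" by (metis prod.collapse)
  define a b c where "a = list_encode qs1" "b = list_encode qsP"
    "c = list_encode (map transition_encode ts)"
  let ?n = "input_counter a b c"
  let ?x = "(machine_vass (decide_code h), (3, [?n, 0]), 0)"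
  have "?x \<in> inputs 2" using input_S[of ?n] by (simp add: emb_def)
  then have "computes f [input_encode ?x] (if P ?x then 1 else 0)" by (rule f)
  moreover have "input_encode ?x = list_encode [a, b, c, 3, list_encode [?n, 0], 0]"
    by (simp add: A a_b_c_def)
  ultimately have "computes h [a, b, c] (if P ?x then 1 else 0)"
    unfolding h_def using computes_Comp1[OF computes_input] by simp
  from decide_code_correct[OF this] have "\<not> P ?x \<longleftrightarrow> halts_from (1, ?n, 0)"
    unfolding halts_from_def by (cases "P ?x") simp_all
  with assms[OF machine_decide_code, of h ?n] show False by blast
qed

theorem theorem5:
  "\<not> decidable (inputs 2) input_encode (almost_sure_reach 2) \<and>
    \<not> decidable (inputs 2) input_encode (limit_sure_reach 2) \<and>
    \<not> decidable (inputs 2) input_encode (almost_sure_repeated_reach 2) \<and>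
    \<not> decidable (inputs 2) input_encode (limit_sure_repeated_reach 2)"
proof (intro conjI)
  have emb: "emb (1, n, 0) = (3, [n, 0])" for n by (simp add: emb_def)
  show "\<not> decidable (inputs 2) input_encode (almost_sure_reach 2)"
    by (rule not_decidable) (simp only: almost_sure_reach.simps machine.almost_sure_iff flip: emb)
  show "\<not> decidable (inputs 2) input_encode (limit_sure_reach 2)"
    by (rule not_decidable) (simp only: limit_sure_reach.simps machine.limit_sure_iff flip: emb)
  show "\<not> decidable (inputs 2) input_encode (almost_sure_repeated_reach 2)"
    by (rule not_decidable) (simp only: almost_sure_repeated_reach.simps machine.almost_sure_iff
        machine.repeated_reach_S flip: emb)
  show "\<not> decidable (inputs 2) input_encode (limit_sure_repeated_reach 2)"
    by (rule not_decidable) (simp only: limit_sure_repeated_reach.simps machine.limit_sure_iff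
        machine.repeated_reach_S flip: emb)
qed

end
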